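(* For all integers $n,k\ge 1$, each of the six statistics $$\mathrm{mak}+\mathrm{bInv},\quad \mathrm{mak}+\mathrm{bInv}-(\mathrm{inv}-\mathrm{cinv}),\quad \mathrm{lmak}+\mathrm{bInv},\quad \mathrm{lmak}+\mathrm{bInv}-(\mathrm{inv}-\mathrm{cinv}),\quad \mathrm{cinvLSB},\quad \mathrm{cinvLSB}+(\mathrm{inv}-\mathrm{cinv})$$ is Euler-Mahonian, i.e. for each such statistic $\mathrm{Stat}$, $$\sum_{\pi\in\mathcal{OP}_n^k}q^{\mathrm{Stat}(\pi)}=[k]_q!\,S_q(n,k).$$
   Context: $[n]_q=1+q+\dots+q^{n-1}$, $[k]_q!=[1]_q\cdots[k]_q$. The $q$-Stirling numbers of the second kind are defined by $S_q(n,k)=q^{k-1}S_q(n-1,k-1)+[k]_qS_q(n-1,k)$ for $n,k\ge1$, with $S_q(n,k)=\delta_{nk}$ if $n=0$ or $k=0$. An ordered partition of $[n]$ into $k$ blocks is a sequence $\pi=(B_1,\dots,B_k)$ of nonempty pairwise disjoint sets with union $[n]$; $\mathcal{OP}_n^k$ is the set of these. Opener/closer of a block = its least/greatest element; $\mathrm{open}(\pi)$, $\mathrm{clos}(\pi)$ the sets of openers/closers; $\mathrm{block}(i)=j$ iff $i\in B_j$. For $i\in[n]$: $\mathrm{ros}_i=\#\{j\in\mathrm{open}(\pi): j<i,\ \mathrm{block}(j)>\mathrm{block}(i)\}$, $\mathrm{los}_i=\#\{j\in\mathrm{open}(\pi): j<i,\ \mathrm{block}(j)<\mathrm{block}(i)\}$,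 $\mathrm{rcs}_i=\#\{j\in\mathrm{clos}(\pi): j<i,\ \mathrm{block}(j)>\mathrm{block}(i)\}$, $\mathrm{lcs}_i=\#\{j\in\mathrm{clos}(\pi): j<i,\ \mathrm{block}(j)<\mathrm{block}(i)\}$, $\mathrm{lsb}_i$ = number of blocks $B$ to the left of the block containing $i$ with $\min B<i<\max B$. Each statistic $s$ is $s(\pi)=\sum_i s_i(\pi)$. $\mathrm{bInv}(\pi)$ = number of pairs $a<b$ such that all elements of $B_a$ exceed all elements of $B_b$. $\mathrm{inv}(\pi)$ = number of pairs $a<b$ with $\min B_a>\min B_b$ (the inversion number of the permutation of blocks relative to their order by minima), $\mathrm{cinv}=\binom{k}{2}-\mathrm{inv}$. $\mathrm{mak}=\mathrm{ros}+\mathrm{lcs}$, $\mathrm{lmak}=n(k-1)-(\mathrm{los}+\mathrm{rcs})$, $\mathrm{cinvLSB}=\mathrm{lsb}+\bigl(\binom{k}{2}-\mathrm{bInv}\bigr)+\binom{k}{2}$. *)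

theory Defs
  imports "HOL-Computational_Algebra.Formal_Laurent_Series" "HOL-Library.Disjoint_Sets"
begin

definition q_int :: "'a::comm_ring_1 \<Rightarrow> nat \<Rightarrow> 'a" where
  "q_int q n = (\<Sum>i<n. q ^ i)"

definition q_fact :: "'a::comm_ring_1 \<Rightarrow> nat \<Rightarrow> 'a" where
  "q_fact q k = (\<Prod>i=1..k. q_int q i)"

fun q_stirling :: "'a::comm_ring_1 \<Rightarrow> nat \<Rightarrow> nat \<Rightarrow> 'a" where
  "q_stirling q 0 0 = 1"
| "q_stirling q 0 (Suc k) = 0"
| "q_stirling q (Suc n) 0 = 0"
| "q_stirling q (Suc n) (Suc k) =
     q ^ k * q_stirling q n k + q_int q (Suc k) * q_stirling q n (Suc k)"

text \<open>The block \<open>B\<^sub>j\<close> of an ordered partition is \<open>\<pi> ! (j - 1)\<close>: positions count from 0.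
  All statistics below only compare positions, so the shift is harmless.\<close>

definition ordered_partitions :: "nat \<Rightarrow> nat \<Rightarrow> nat set list set" where
  "ordered_partitions n k =
     {\<pi>. length \<pi> = k \<and> (\<forall>B\<in>set \<pi>. B \<noteq> {}) \<and>
         disjoint_family_on (\<lambda>j. \<pi> ! j) {..<k} \<and> \<Union>(set \<pi>) = {1..n}}"

definition openers :: "nat set list \<Rightarrow> nat set" where
  "openers \<pi> = Min ` set \<pi>"

definition closers :: "nat set list \<Rightarrow> nat set" where
  "closers \<pi> = Max ` set \<pi>"

definition block :: "nat set list \<Rightarrow> nat \<Rightarrow> nat" where
  "block \<pi> i = (THE j. j < length \<pi> \<and> i \<in> \<pi> ! j)"

definition ros_at :: "nat set list \<Rightarrow> nat \<Rightarrow> nat" where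
  "ros_at \<pi> i = card {j \<in> openers \<pi>. j < i \<and> block \<pi> j > block \<pi> i}"

definition los_at :: "nat set list \<Rightarrow> nat \<Rightarrow> nat" where
  "los_at \<pi> i = card {j \<in> openers \<pi>. j < i \<and> block \<pi> j < block \<pi> i}"

definition rcs_at :: "nat set list \<Rightarrow> nat \<Rightarrow> nat" where
  "rcs_at \<pi> i = card {j \<in> closers \<pi>. j < i \<and> block \<pi> j > block \<pi> i}"

definition lcs_at :: "nat set list \<Rightarrow> nat \<Rightarrow> nat" where
  "lcs_at \<pi> i = card {j \<in> closers \<pi>. j < i \<and> block \<pi> j < block \<pi> i}"

definition lsb_at :: "nat set list \<Rightarrow> nat \<Rightarrow> nat" where
  "lsb_at \<pi> i = card {b. b < block \<pi> i \<and> Min (\<pi> ! b) < i \<and> i < Max (\<pi> ! b)}"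

definition stat_sum :: "(nat set list \<Rightarrow> nat \<Rightarrow> nat) \<Rightarrow> nat set list \<Rightarrow> int" where
  "stat_sum s \<pi> = int (\<Sum>i\<in>\<Union>(set \<pi>). s \<pi> i)"

definition bInv :: "nat set list \<Rightarrow> int" where
  "bInv \<pi> = int (card {(a, b). a < b \<and> b < length \<pi> \<and> (\<forall>x\<in>\<pi> ! a. \<forall>y\<in>\<pi> ! b. x > y)})"

definition op_inv :: "nat set list \<Rightarrow> int" where
  "op_inv \<pi> = int (card {(a, b). a < b \<and> b < length \<pi> \<and> Min (\<pi> ! a) > Min (\<pi> ! b)})"

definition op_cinv :: "nat set list \<Rightarrow> int" where
  "op_cinv \<pi> = int (length \<pi> choose 2) - op_inv \<pi>"

definition mak :: "nat set list \<Rightarrow> int" where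
  "mak \<pi> = stat_sum ros_at \<pi> + stat_sum lcs_at \<pi>"

definition lmak :: "nat set list \<Rightarrow> int" where
  "lmak \<pi> = int (card (\<Union>(set \<pi>))) * (int (length \<pi>) - 1) - (stat_sum los_at \<pi> + stat_sum rcs_at \<pi>)"

definition cinvLSB :: "nat set list \<Rightarrow> int" where
  "cinvLSB \<pi> = stat_sum lsb_at \<pi> + (int (length \<pi> choose 2) - bInv \<pi>) + int (length \<pi> choose 2)"

text \<open>The identity is one in the formal variable \<open>q\<close>. Some statistics are defined by subtraction,
  so exponents are integers and \<open>q\<close> is taken in the ring of formal Laurent series; no truncation
  of exponents occurs.\<close>

definition euler_mahonian :: "nat \<Rightarrow> nat \<Rightarrow> (nat set list \<Rightarrow> int) \<Rightarrow> bool" where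
  "euler_mahonian n k stat \<longleftrightarrow>
     (let q = (fls_X :: rat fls) in
       (\<Sum>\<pi>\<in>ordered_partitions n k. q powi stat \<pi>) = q_fact q k * q_stirling q n k)"

end

theory Submission
  imports Defs
begin

text \<open>Up to constants depending on \<open>n\<close> and \<open>k\<close>, each of the six statistics is a sum over pairs of
  blocks. Build an ordered partition by inserting \<open>1, 2, \<dots>, n\<close> in turn, remembering which blocks are
  already closed. With \<open>c\<close> closed and \<open>a\<close> active blocks, the increase of the statistic runs over a
  translate of \<open>{0..c + a}\<close> as the next element opens a block in one of the \<open>c + a + 1\<close> gaps, and over
  a translate of \<open>{0..a - 1}\<close> as it joins one of the active blocks. So the generating function is
  a sum over lattice walks in \<open>(c, a)\<close>. For \<open>mak\<close> and \<open>cinvLSB\<close> the partial sums over walks from \<open>(0, 0)\<close>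
  to \<open>(c, a)\<close> are products of \<open>q\<close>-factorials, a power of \<open>q\<close> and a \<open>q\<close>-Stirling number; for \<open>lmak\<close> this
  holds for the sums over walks from \<open>(c, a)\<close> to \<open>(k, 0)\<close>. In every case the recurrence reduces to
  \<open>[c + a] = [c] + q\<^bsup>c\<^esup>[a]\<close>.\<close>

section \<open>Sums over pairs of list entries\<close>

fun pair_sum :: "('a \<Rightarrow> 'a \<Rightarrow> int) \<Rightarrow> 'a list \<Rightarrow> int" where
  "pair_sum g [] = 0"
| "pair_sum g (x # xs) = (\<Sum>y\<leftarrow>xs. g x y) + pair_sum g xs"

lemma pair_sum_append:
  "pair_sum g (xs @ ys) = pair_sum g xs + pair_sum g ys + (\<Sum>x\<leftarrow>xs. \<Sum>y\<leftarrow>ys. g x y)"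
  by (induction xs) (simp_all add: algebra_simps)

text \<open>Reverse induction fits the double sum: a new last entry adds exactly the summand at the
  outer index \<open>length xs\<close>.\<close>

lemma pair_sum_conv_nth:
  "pair_sum g xs = (\<Sum>b<length xs. \<Sum>a<b. g (xs ! a) (xs ! b))"
proof (induction xs rule: rev_induct)
  case Nil
  then show ?case by simp
next
  case (snoc x xs)
  have "(\<Sum>b<length xs. \<Sum>a<b. g ((xs @ [x]) ! a) ((xs @ [x]) ! b)) =
      (\<Sum>b<length xs. \<Sum>a<b. g (xs ! a) (xs ! b))"
    by (intro sum.cong refl) (simp add: nth_append)
  moreover have "(\<Sum>y\<leftarrow>xs. g y x) = (\<Sum>a<length xs. g ((xs @ [x]) ! a) x)"
    by (simp add: sum_list_sum_nth atLeast0LessThan nth_append)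
  ultimately show ?case
    using snoc by (simp add: pair_sum_append)
qed

lemma pair_sum_map: "pair_sum g (map f xs) = pair_sum (\<lambda>x y. g (f x) (f y)) xs"
  by (induction xs) (simp_all add: comp_def)

lemma pair_sum_add: "pair_sum (\<lambda>x y. g x y + h x y) xs = pair_sum g xs + pair_sum h xs"
  by (simp add: pair_sum_conv_nth sum.distrib)

lemma pair_sum_diff: "pair_sum (\<lambda>x y. g x y - h x y) xs = pair_sum g xs - pair_sum h xs"
  by (simp add: pair_sum_conv_nth sum_subtractf)

section \<open>Marked ordered partitions\<close>

text \<open>A block carries the mark \<open>True\<close> if it is closed, that is, if no larger element will be put
  into it later.\<close>

type_synonym mblock = "nat set \<times> bool"

text \<open>The marks are unconstrained, so an ordered partition into \<open>k\<close> blocks occurs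
  with all \<open>2 ^ k\<close> markings. A mark is a promise about later insertions, not a property
  of the block.\<close>

definition marked :: "nat \<Rightarrow> mblock list set" where
  "marked n = {xs. map fst xs \<in> ordered_partitions n (length xs)}"

definition closed_count :: "mblock list \<Rightarrow> nat" where
  "closed_count xs = length (filter snd xs)"

definition active_count :: "mblock list \<Rightarrow> nat" where
  "active_count xs = length (filter (\<lambda>x. \<not> snd x) xs)"

lemma closed_count_simps [simp]:
  "closed_count [] = 0"
  "closed_count (x # xs) = of_bool (snd x) + closed_count xs"
  "closed_count (xs @ ys) = closed_count xs + closed_count ys"
  by (simp_all add: closed_count_def)

lemma active_count_simps [simp]:
  "active_count [] = 0"
  "active_count (x # xs) = of_bool (\<not> snd x) + active_count xs"
  "active_count (xs @ ys) = active_count xs + active_count ys"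
  by (simp_all add: active_count_def)

lemma length_eq_closed_active: "length xs = closed_count xs + active_count xs"
  by (induction xs) auto

text \<open>Disjointness says that each \<open>i\<close> lies in at most one block, and the union
  condition that it lies in some block exactly when it belongs to \<open>{1..n}\<close>. Stated as a
  count per element, the condition is additive over \<open>@\<close>, which suits insertion in the
  middle of a list.\<close>

lemma ordered_partitions_iff_filter:
  "\<pi> \<in> ordered_partitions n (length \<pi>) \<longleftrightarrow>
     (\<forall>B\<in>set \<pi>. B \<noteq> {}) \<and> (\<forall>i. length (filter (\<lambda>B. i \<in> B) \<pi>) = of_bool (i \<in> {1..n}))"
proof -
  let ?J = "\<lambda>i. {j. j < length \<pi> \<and> i \<in> \<pi> ! j}"
  have card: "length (filter (\<lambda>B. i \<in> B) \<pi>) = card (?J i)" for i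
    by (simp add: length_filter_conv_card)
  have fin: "finite (?J i)" for i
    by simp
  have un: "i \<in> \<Union>(set \<pi>) \<longleftrightarrow> ?J i \<noteq> {}" for i
    by (simp add: Bex_def set_conv_nth) blast
  have "disjoint_family_on (\<lambda>j. \<pi> ! j) {..<length \<pi>} \<longleftrightarrow> (\<forall>i. card (?J i) \<le> 1)"
    by (auto simp: disjoint_family_on_def card_le_Suc0_iff_eq[OF fin])
  moreover have "\<Union>(set \<pi>) = {1..n} \<longleftrightarrow> (\<forall>i. card (?J i) > 0 \<longleftrightarrow> i \<in> {1..n})"
    unfolding set_eq_iff un using fin by (simp add: card_gt_0_iff)
  moreover have "(\<forall>i. card (?J i) \<le> 1) \<and> (\<forall>i. card (?J i) > 0 \<longleftrightarrow> i \<in> {1..n}) \<longleftrightarrow>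
      (\<forall>i. card (?J i) = of_bool (i \<in> {1..n}))" (is "?L \<longleftrightarrow> ?R")
  proof
    assume L: ?L
    show ?R
    proof
      fix i
      have "card (?J i) \<le> 1" "card (?J i) > 0 \<longleftrightarrow> i \<in> {1..n}"
        using L by blast+
      then show "card (?J i) = of_bool (i \<in> {1..n})"
        by (cases "i \<in> {1..n}") auto
    qed
  next
    assume ?R
    then show ?L
      by (simp add: of_bool_def split: if_splits)
  qed
  ultimately show ?thesis
    unfolding ordered_partitions_def card by auto
qed

definition multiplicity_in :: "nat \<Rightarrow> mblock list \<Rightarrow> nat" where
  "multiplicity_in i xs = length (filter (\<lambda>x. i \<in> fst x) xs)"

lemma multiplicity_in_simps [simp]:
  "multiplicity_in i [] = 0"
  "multiplicity_in i (x # xs) = of_bool (i \<in> fst x) + multiplicity_in i xs"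
  "multiplicity_in i (xs @ ys) = multiplicity_in i xs + multiplicity_in i ys"
  by (simp_all add: multiplicity_in_def)

lemma multiplicity_in_eq_0_iff: "multiplicity_in i xs = 0 \<longleftrightarrow> (\<forall>x\<in>set xs. i \<notin> fst x)"
  by (induction xs) auto

lemma marked_iff:
  "xs \<in> marked n \<longleftrightarrow>
     (\<forall>x\<in>set xs. fst x \<noteq> {}) \<and> (\<forall>i. multiplicity_in i xs = of_bool (i \<in> {1..n}))"
  using ordered_partitions_iff_filter[of "map fst xs" n]
  by (simp add: marked_def multiplicity_in_def filter_map comp_def)

lemma marked_block:
  assumes "xs \<in> marked n" and "x \<in> set xs"
  shows "finite (fst x)" "fst x \<noteq> {}" "fst x \<subseteq> {1..n}"
proof -
  show sub: "fst x \<subseteq> {1..n}"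
  proof
    fix i assume "i \<in> fst x"
    then have "multiplicity_in i xs \<noteq> 0"
      using assms(2) by (auto simp: multiplicity_in_eq_0_iff)
    then show "i \<in> {1..n}"
      using assms(1) by (auto simp: marked_iff of_bool_def split: if_splits)
  qed
  show "finite (fst x)"
    using sub finite_subset by blast
  show "fst x \<noteq> {}"
    using assms by (auto simp: marked_iff)
qed

section \<open>Inserting a new largest element\<close>

text \<open>In a triple \<open>(xs, p, b)\<close>, \<open>p\<close> is the gap or the block chosen,
  and \<open>b\<close> is the mark given to the block that now contains \<open>N\<close>.\<close>

definition insert_new :: "nat \<Rightarrow> mblock list \<times> nat \<times> bool \<Rightarrow> mblock list" where
  "insert_new N = (\<lambda>(xs, p, b). take p xs @ ({N}, b) # drop p xs)"

definition insert_into :: "nat \<Rightarrow> mblock list \<times> nat \<times> bool \<Rightarrow> mblock list" where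
  "insert_into N = (\<lambda>(xs, p, b). take p xs @ (insert N (fst (xs ! p)), b) # drop (Suc p) xs)"

definition new_slots :: "nat \<Rightarrow> (mblock list \<times> nat \<times> bool) set" where
  "new_slots n = (SIGMA xs:marked n. {..<Suc (length xs)} \<times> UNIV)"

definition active_slots :: "nat \<Rightarrow> (mblock list \<times> nat \<times> bool) set" where
  "active_slots n = (SIGMA xs:marked n. {p. p < length xs \<and> \<not> snd (xs ! p)} \<times> UNIV)"

lemma marked_notin: "xs \<in> marked n \<Longrightarrow> x \<in> set xs \<Longrightarrow> Suc n \<notin> fst x"
  using marked_block(3)[of xs n x] by auto

text \<open>The prefix is recovered as the longest one whose blocks avoid \<open>N\<close>, so the
  block containing \<open>N\<close> reveals where the insertion took place.\<close>

lemma append_Cons_unique_block: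
  assumes "us @ x # vs = us' @ x' # vs'"
    and "\<forall>y\<in>set us \<union> set us'. N \<notin> fst y" and "N \<in> fst x" "N \<in> fst x'"
  shows "us = us' \<and> x = x' \<and> vs = vs'"
proof -
  have "takeWhile (\<lambda>y. N \<notin> fst y) (us @ x # vs) = us"
    and "takeWhile (\<lambda>y. N \<notin> fst y) (us' @ x' # vs') = us'"
    using assms(2-4) by (auto simp: takeWhile_append)
  then show ?thesis
    using assms(1) by auto
qed

lemma insert_new_in_marked:
  assumes "s \<in> new_slots n"
  shows "insert_new (Suc n) s \<in> marked (Suc n)"
proof -
  obtain xs p b where s: "s = (xs, p, b)" by (cases s)
  define us vs where "us = take p xs" and "vs = drop p xs"
  have "xs = us @ vs" "xs \<in> marked n"
    using assms by (auto simp: s new_slots_def us_def vs_def)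
  then have *: "\<forall>x\<in>set (us @ vs). fst x \<noteq> {}"
      "\<And>i. multiplicity_in i (us @ vs) = of_bool (i \<in> {1..n})"
    by (auto simp: marked_iff simp del: multiplicity_in_simps)
  have "multiplicity_in i (us @ ({Suc n}, b) # vs) = of_bool (i \<in> {1..Suc n})" for i
    using *(2)[of i] by (cases "i = Suc n") (auto simp: le_Suc_eq)
  then show ?thesis
    unfolding s insert_new_def marked_iff prod.case us_def[symmetric] vs_def[symmetric]
    using *(1) by auto
qed

lemma insert_into_in_marked:
  assumes "s \<in> active_slots n"
  shows "insert_into (Suc n) s \<in> marked (Suc n)"
proof -
  obtain xs p b where s: "s = (xs, p, b)" by (cases s)
  define us vs where "us = take p xs" and "vs = drop (Suc p) xs"
  have "xs = us @ xs ! p # vs" and xs: "xs \<in> marked n"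
    using assms id_take_nth_drop by (auto simp: s active_slots_def us_def vs_def)
  moreover define x where "x = xs ! p"
  ultimately have eq: "xs = us @ x # vs" by simp
  have *: "\<forall>x\<in>set us \<union> set vs. fst x \<noteq> {}"
      "\<And>i. multiplicity_in i (us @ x # vs) = of_bool (i \<in> {1..n})"
    using xs unfolding eq by (auto simp: marked_iff simp del: multiplicity_in_simps)
  have mult: "multiplicity_in i (us @ (insert (Suc n) (fst x), b) # vs) =
      of_bool (i \<in> {1..Suc n})" for i
  proof (cases "i = Suc n")
    case True
    then show ?thesis
      using *(2)[of i] by simp
  next
    case False
    then show ?thesis
      using *(2)[of i] by (auto simp: le_Suc_eq)
  qed
  show ?thesis
    unfolding s insert_into_def marked_iff x_def[symmetric] prod.case
      us_def[symmetric] vs_def[symmetric]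
    using *(1) mult by auto
qed

lemma inj_on_insert_new: "inj_on (insert_new (Suc n)) (new_slots n)"
proof (rule inj_onI)
  fix s s'
  assume S: "s \<in> new_slots n" "s' \<in> new_slots n" "insert_new (Suc n) s = insert_new (Suc n) s'"
  obtain xs p b xs' p' b' where s: "s = (xs, p, b)" "s' = (xs', p', b')"
    by (cases s, cases s')
  have xs: "xs \<in> marked n" "xs' \<in> marked n" "p \<le> length xs" "p' \<le> length xs'"
    using S by (auto simp: new_slots_def s)
  have "take p xs = take p' xs' \<and> ({Suc n}, b) = ({Suc n}, b') \<and> drop p xs = drop p' xs'"
  proof (rule append_Cons_unique_block)
    show "take p xs @ ({Suc n}, b) # drop p xs = take p' xs' @ ({Suc n}, b') # drop p' xs'"
      using S by (simp add: insert_new_def s)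
    show "\<forall>y\<in>set (take p xs) \<union> set (take p' xs'). Suc n \<notin> fst y"
      using xs marked_notin by (blast dest: in_set_takeD)
  qed auto
  moreover from this have "p = p'"
    using xs by (metis length_take min.absorb2)
  ultimately show "s = s'"
    unfolding s by (metis append_take_drop_id prod.inject)
qed

lemma inj_on_insert_into: "inj_on (insert_into (Suc n)) (active_slots n)"
proof (rule inj_onI)
  fix s s'
  assume S: "s \<in> active_slots n" "s' \<in> active_slots n"
    "insert_into (Suc n) s = insert_into (Suc n) s'"
  obtain xs p b xs' p' b' where s: "s = (xs, p, b)" "s' = (xs', p', b')"
    by (cases s, cases s')
  have xs: "xs \<in> marked n" "xs' \<in> marked n" "p < length xs" "p' < length xs'"
    "\<not> snd (xs ! p)" "\<not> snd (xs' ! p')"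
    using S by (auto simp: active_slots_def s)
  have *: "take p xs = take p' xs' \<and>
      (insert (Suc n) (fst (xs ! p)), b) = (insert (Suc n) (fst (xs' ! p')), b') \<and>
      drop (Suc p) xs = drop (Suc p') xs'"
  proof (rule append_Cons_unique_block)
    show "take p xs @ (insert (Suc n) (fst (xs ! p)), b) # drop (Suc p) xs =
        take p' xs' @ (insert (Suc n) (fst (xs' ! p')), b') # drop (Suc p') xs'"
      using S by (simp add: insert_into_def s)
    show "\<forall>y\<in>set (take p xs) \<union> set (take p' xs'). Suc n \<notin> fst y"
      using xs marked_notin by (blast dest: in_set_takeD)
  qed auto
  then have "p = p'"
    using xs by (metis length_take min.absorb2 order_less_imp_le)
  have "Suc n \<notin> fst (xs ! p)" "Suc n \<notin> fst (xs' ! p')"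
    using xs marked_notin nth_mem by blast+
  then have "fst (xs ! p) = fst (xs' ! p')"
    using * by (simp add: insert_ident)
  \<comment> \<open>Only active blocks are enlarged, so both old marks are \<open>False\<close> and
    equality of the underlying sets suffices.\<close>
  then have "xs ! p = xs' ! p'"
    using xs by (simp add: prod_eq_iff)
  then have "xs = xs'"
    using * xs id_take_nth_drop by metis
  then show "s = s'"
    using * \<open>p = p'\<close> s by simp
qed

lemma insert_new_neq_insert_into:
  assumes "s \<in> new_slots n" and "s' \<in> active_slots n"
  shows "insert_new (Suc n) s \<noteq> insert_into (Suc n) s'"
proof
  assume eq: "insert_new (Suc n) s = insert_into (Suc n) s'"
  obtain xs p b xs' p' b' where s: "s = (xs, p, b)" "s' = (xs', p', b')"
    by (cases s, cases s')
  have xs: "xs \<in> marked n" "xs' \<in> marked n" "p \<le> length xs" "p' < length xs'"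
    using assms by (auto simp: new_slots_def active_slots_def s)
  have "take p xs = take p' xs' \<and>
      ({Suc n}, b) = (insert (Suc n) (fst (xs' ! p')), b') \<and> drop p xs = drop (Suc p') xs'"
  proof (rule append_Cons_unique_block)
    show "take p xs @ ({Suc n}, b) # drop p xs =
        take p' xs' @ (insert (Suc n) (fst (xs' ! p')), b') # drop (Suc p') xs'"
      using eq by (simp add: insert_new_def insert_into_def s)
    show "\<forall>y\<in>set (take p xs) \<union> set (take p' xs'). Suc n \<notin> fst y"
      using xs marked_notin by (blast dest: in_set_takeD)
  qed auto
  moreover have "Suc n \<notin> fst (xs' ! p')" "fst (xs' ! p') \<noteq> {}"
    using xs marked_notin marked_block(2) nth_mem by blast+
  ultimately show False
    by auto
qed

text \<open>Deleting \<open>Suc n\<close> inverts the two insertions: a singleton block disappears,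
  any other block shrinks.\<close>

lemma marked_Suc:
  "marked (Suc n) = insert_new (Suc n) ` new_slots n \<union> insert_into (Suc n) ` active_slots n"
proof (intro equalityI subsetI)
  fix ys assume ys: "ys \<in> marked (Suc n)"
  have nonempty: "\<And>y. y \<in> set ys \<Longrightarrow> fst y \<noteq> {}"
    and mult: "\<And>i. multiplicity_in i ys = of_bool (i \<in> {1..Suc n})"
    using ys by (auto simp: marked_iff)
  have "multiplicity_in (Suc n) ys \<noteq> 0"
    by (simp add: mult)
  then obtain y where "y \<in> set ys" "Suc n \<in> fst y"
    by (auto simp: multiplicity_in_eq_0_iff)
  then obtain us vs where eq: "ys = us @ y # vs"
    by (auto simp: in_set_conv_decomp)
  obtain B b where y: "y = (B, b)" by (cases y)
  have B: "Suc n \<in> B" using \<open>Suc n \<in> fst y\<close> y by simp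
  have zero: "multiplicity_in (Suc n) us = 0" "multiplicity_in (Suc n) vs = 0"
    using mult[of "Suc n"] B by (auto simp: eq y)
  show "ys \<in> insert_new (Suc n) ` new_slots n \<union> insert_into (Suc n) ` active_slots n"
  proof (cases "B = {Suc n}")
    case True
    have "multiplicity_in i (us @ vs) = of_bool (i \<in> {1..n})" for i
      using mult[of i] zero by (cases "i = Suc n") (auto simp: eq y True le_Suc_eq)
    then have "us @ vs \<in> marked n"
      using nonempty by (auto simp: marked_iff eq simp del: multiplicity_in_simps)
    then have "(us @ vs, length us, b) \<in> new_slots n"
      by (auto simp: new_slots_def)
    moreover have "ys = insert_new (Suc n) (us @ vs, length us, b)"
      by (simp add: insert_new_def eq y True)
    ultimately show ?thesis by blast
  next
    case False
    \<comment> \<open>The shrunken block has to be active, since it still receives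
      \<open>Suc n\<close>; the present mark \<open>b\<close> survives in the triple.\<close>
    let ?xs = "us @ (B - {Suc n}, False) # vs"
    have "multiplicity_in i ?xs = of_bool (i \<in> {1..n})" for i
      using mult[of i] zero by (cases "i = Suc n") (auto simp: eq y le_Suc_eq)
    then have "?xs \<in> marked n"
      using nonempty B False by (auto simp: marked_iff eq simp del: multiplicity_in_simps)
    then have "(?xs, length us, b) \<in> active_slots n"
      by (auto simp: active_slots_def)
    moreover have "ys = insert_into (Suc n) (?xs, length us, b)"
      using B by (auto simp: insert_into_def eq y)
    ultimately show ?thesis by blast
  qed
qed (auto intro: insert_new_in_marked insert_into_in_marked)

lemma marked_0: "marked 0 = {[]}"
proof (intro equalityI subsetI)
  fix xs assume "xs \<in> marked 0"
  then have "\<And>x. x \<in> set xs \<Longrightarrow> False"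
    using marked_block(2,3) by fastforce
  then show "xs \<in> {[]}"
    by (cases xs) auto
qed (simp add: marked_iff)

lemma finite_marked: "finite (marked n)"
  by (induction n) (auto simp: marked_0 marked_Suc new_slots_def active_slots_def)

text \<open>The two insertions are injective with disjoint images, so the sum splits according to
  the way in which \<open>Suc n\<close> arrived.\<close>

lemma sum_marked_Suc:
  fixes f :: "mblock list \<Rightarrow> 'a::comm_monoid_add"
  shows "(\<Sum>ys\<in>marked (Suc n). f ys) =
    (\<Sum>xs\<in>marked n.
       (\<Sum>p<Suc (length xs). \<Sum>b\<in>UNIV. f (insert_new (Suc n) (xs, p, b))) +
       (\<Sum>p | p < length xs \<and> \<not> snd (xs ! p). \<Sum>b\<in>UNIV. f (insert_into (Suc n) (xs, p, b))))"
proof -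
  have fin: "finite (new_slots n)" "finite (active_slots n)"
    using finite_marked by (auto simp: new_slots_def active_slots_def)
  have "(\<Sum>ys\<in>marked (Suc n). f ys) =
      (\<Sum>s\<in>new_slots n. f (insert_new (Suc n) s)) + (\<Sum>s\<in>active_slots n. f (insert_into (Suc n) s))"
    unfolding marked_Suc using fin insert_new_neq_insert_into
    by (subst sum.union_disjoint)
      (auto simp: sum.reindex inj_on_insert_new inj_on_insert_into)
  then show ?thesis
    unfolding new_slots_def active_slots_def
    by (simp add: sum.Sigma finite_marked sum.distrib case_prod_unfold del: sum.lessThan_Suc)
qed

text \<open>The positions satisfying \<open>P\<close> are numbered from left to right; number
  \<open>j\<close> has \<open>j\<close> such positions before it and all others after it.\<close>

lemma sum_satisfying_positions:
  fixes h :: "nat \<Rightarrow> nat \<Rightarrow> 'a::comm_monoid_add"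
  shows "(\<Sum>p | p < length xs \<and> P (xs ! p).
            h (length (filter P (take p xs))) (length (filter P (drop (Suc p) xs)))) =
         (\<Sum>j<length (filter P xs). h j (length (filter P xs) - Suc j))"
proof -
  have "(\<Sum>p<length xs. if P (xs ! p)
            then h (length (filter P (take p xs))) (length (filter P (drop (Suc p) xs))) else 0) =
         (\<Sum>j<length (filter P xs). h j (length (filter P xs) - Suc j))"
  proof (induction xs arbitrary: h)
    case Nil
    then show ?case by simp
  next
    case (Cons x xs)
    show ?case
    proof (cases "P x")
      \<comment> \<open>A satisfying head adds one to every left count, hence the induction
        hypothesis is taken at the shifted \<open>h\<close>.\<close>
      case True
      then show ?thesis
        using Cons[of "\<lambda>j. h (Suc j)"] by (simp add: sum.lessThan_Suc_shift del: sum.lessThan_Suc cong: if_cong)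
    next
      case False
      then show ?thesis
        using Cons[of h] by (simp add: sum.lessThan_Suc_shift del: sum.lessThan_Suc cong: if_cong)
    qed
  qed
  then show ?thesis
    by (simp flip: sum.inter_filter)
qed

section \<open>Change of the pair sum under an insertion\<close>

lemma sum_list_closed_active:
  "(\<Sum>x\<leftarrow>xs. if snd x then u else (v::int)) =
     u * int (closed_count xs) + v * int (active_count xs)"
  by (induction xs) (auto simp: algebra_simps)

text \<open>Among \<open>N\<close> places in a row, place \<open>j\<close> has \<open>j\<close>
  places to its left and \<open>N - Suc j\<close> to its right; these contribute \<open>x\<close>
  and \<open>y\<close> each to the exponent.\<close>

definition geom :: "'a::field \<Rightarrow> int \<Rightarrow> int \<Rightarrow> nat \<Rightarrow> 'a" where
  "geom q x y N = (\<Sum>j<N. q powi (x * int j + y * int (N - Suc j)))"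

text \<open>Inserting a new largest element raises the pair sum by an amount determined by the numbers of
  closed and of active blocks on either side. Next to a new singleton block, a block on the left or
  right contributes \<open>l\<close> or \<open>r\<close>, plus \<open>d\<close> if it is closed. Next to an enlarged active block, a closed
  block contributes \<open>e\<close>, and an active block on the left or right contributes \<open>l'\<close> or \<open>r'\<close>.\<close>

locale scan_stat =
  fixes g :: "mblock \<Rightarrow> mblock \<Rightarrow> int" and d l r e l' r' :: int
  assumes new_left: "\<And>A s N b. finite A \<Longrightarrow> A \<noteq> {} \<Longrightarrow> \<forall>i\<in>A. i < N \<Longrightarrow>
      g (A, s) ({N}, b) = d * of_bool s + l"
    and new_right: "\<And>B t N b. finite B \<Longrightarrow> B \<noteq> {} \<Longrightarrow> \<forall>i\<in>B. i < N \<Longrightarrow>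
      g ({N}, b) (B, t) = d * of_bool t + r"
    and into_left: "\<And>A X s N b. finite A \<Longrightarrow> A \<noteq> {} \<Longrightarrow> \<forall>i\<in>A. i < N \<Longrightarrow>
      finite X \<Longrightarrow> X \<noteq> {} \<Longrightarrow> \<forall>i\<in>X. i < N \<Longrightarrow>
      g (A, s) (insert N X, b) = g (A, s) (X, False) + (if s then e else l')"
    and into_right: "\<And>B X t N b. finite B \<Longrightarrow> B \<noteq> {} \<Longrightarrow> \<forall>i\<in>B. i < N \<Longrightarrow>
      finite X \<Longrightarrow> X \<noteq> {} \<Longrightarrow> \<forall>i\<in>X. i < N \<Longrightarrow>
      g (insert N X, b) (B, t) = g (X, False) (B, t) + (if t then e else r')"
begin

text \<open>Closed blocks add the same surplus \<open>d\<close> on both sides, so the gap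
  \<open>p\<close> matters only through the numbers of blocks to its left and right.\<close>

lemma pair_sum_insert_new:
  assumes "xs \<in> marked n" and "p \<le> length xs"
  shows "pair_sum g (insert_new (Suc n) (xs, p, b)) =
    pair_sum g xs + d * int (closed_count xs) + l * int p + r * int (length xs - p)"
proof -
  define us vs where "us = take p xs" and "vs = drop p xs"
  have eq: "xs = us @ vs" and len: "length us = p" "length vs = length xs - p"
    using assms(2) by (simp_all add: us_def vs_def)
  have block: "finite (fst x) \<and> fst x \<noteq> {} \<and> (\<forall>i\<in>fst x. i < Suc n)" if "x \<in> set us \<union> set vs" for x
    using marked_block[OF assms(1), of x] that unfolding eq by auto
  have "g x ({Suc n}, b) = (if snd x then d + l else l)" if "x \<in> set us" for x
    using block[of x] new_left[of "fst x" "Suc n" "snd x" b] that by simp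
  then have left: "(\<Sum>x\<leftarrow>us. g x ({Suc n}, b)) = (\<Sum>x\<leftarrow>us. if snd x then d + l else l)"
    by (intro arg_cong[where f = sum_list] map_cong refl)
  have "g ({Suc n}, b) y = (if snd y then d + r else r)" if "y \<in> set vs" for y
    using block[of y] new_right[of "fst y" "Suc n" b "snd y"] that by simp
  then have right: "(\<Sum>y\<leftarrow>vs. g ({Suc n}, b) y) = (\<Sum>y\<leftarrow>vs. if snd y then d + r else r)"
    by (intro arg_cong[where f = sum_list] map_cong refl)
  have "pair_sum g (insert_new (Suc n) (xs, p, b)) =
      pair_sum g (us @ vs) + (\<Sum>x\<leftarrow>us. g x ({Suc n}, b)) + (\<Sum>y\<leftarrow>vs. g ({Suc n}, b) y)"
    by (simp add: insert_new_def pair_sum_append sum_list_addf flip: us_def vs_def)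
  then show ?thesis
    unfolding left right sum_list_closed_active len[symmetric] eq
    by (simp add: length_eq_closed_active algebra_simps)
qed

text \<open>Closed blocks contribute \<open>e\<close> on either side, so the choice of
  \<open>p\<close> matters only through the active blocks around it.\<close>

lemma pair_sum_insert_into:
  assumes "xs \<in> marked n" and "p < length xs" and "\<not> snd (xs ! p)"
  shows "pair_sum g (insert_into (Suc n) (xs, p, b)) =
    pair_sum g xs + e * int (closed_count xs) + l' * int (active_count (take p xs)) +
      r' * int (active_count (drop (Suc p) xs))"
proof -
  define us vs X where "us = take p xs" and "vs = drop (Suc p) xs" and "X = fst (xs ! p)"
  have "xs ! p = (X, False)"
    using assms(3) by (simp add: X_def prod_eq_iff)
  then have eq: "xs = us @ (X, False) # vs"
    using id_take_nth_drop[OF assms(2)] by (simp add: us_def vs_def)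
  have block: "finite (fst x) \<and> fst x \<noteq> {} \<and> (\<forall>i\<in>fst x. i < Suc n)"
    if "x \<in> set us \<union> set vs \<union> {(X, False)}" for x
    using marked_block[OF assms(1), of x] that unfolding eq by auto
  have X: "finite X" "X \<noteq> {}" "\<forall>i\<in>X. i < Suc n"
    using block[of "(X, False)"] by auto
  have "g x (insert (Suc n) X, b) = g x (X, False) + (if snd x then e else l')"
    if "x \<in> set us" for x
    using block[of x] into_left[of "fst x" "Suc n" X "snd x" b] X that by simp
  then have left: "(\<Sum>x\<leftarrow>us. g x (insert (Suc n) X, b)) =
      (\<Sum>x\<leftarrow>us. g x (X, False) + (if snd x then e else l'))"
    by (intro arg_cong[where f = sum_list] map_cong refl)
  have "g (insert (Suc n) X, b) y = g (X, False) y + (if snd y then e else r')"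
    if "y \<in> set vs" for y
    using block[of y] into_right[of "fst y" "Suc n" X b "snd y"] X that by simp
  then have right: "(\<Sum>y\<leftarrow>vs. g (insert (Suc n) X, b) y) =
      (\<Sum>y\<leftarrow>vs. g (X, False) y + (if snd y then e else r'))"
    by (intro arg_cong[where f = sum_list] map_cong refl)
  have "pair_sum g (insert_into (Suc n) (xs, p, b)) = pair_sum g us + pair_sum g vs +
      (\<Sum>x\<leftarrow>us. g x (insert (Suc n) X, b)) + (\<Sum>y\<leftarrow>vs. g (insert (Suc n) X, b) y) +
      (\<Sum>x\<leftarrow>us. \<Sum>y\<leftarrow>vs. g x y)"
    by (simp add: insert_into_def pair_sum_append sum_list_addf flip: us_def vs_def X_def)
  then show ?thesis
    unfolding left right sum_list_addf sum_list_closed_active us_def[symmetric] vs_def[symmetric]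
    by (simp add: eq pair_sum_append sum_list_addf algebra_simps)
qed

text \<open>One step of the walk, as an operator on functions \<open>f\<close> of the state. An
  indicator as \<open>f\<close> yields a recurrence by the last step; a function counting
  completions yields one by the next step. The two values of \<open>f\<close> in each bracket belong
  to \<open>b = False\<close> and \<open>b = True\<close>. At \<open>a = 0\<close> the truncated
  \<open>a - 1\<close> does no harm, because \<open>geom q l' r' 0 = 0\<close>.\<close>

theorem sum_marked_scan:
  fixes q :: "'a::field" and f :: "nat \<Rightarrow> nat \<Rightarrow> 'a"
  assumes "q \<noteq> 0"
  shows "(\<Sum>ys\<in>marked (Suc n). q powi pair_sum g ys * f (closed_count ys) (active_count ys)) =
    (\<Sum>xs\<in>marked n. q powi pair_sum g xs *
       (let c = closed_count xs; a = active_count xs in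
          q powi (d * int c) * geom q l r (Suc (c + a)) * (f c (Suc a) + f (Suc c) a) +
          q powi (e * int c) * geom q l' r' a * (f c a + f (Suc c) (a - 1))))"
proof (subst sum_marked_Suc, intro sum.cong refl)
  fix xs assume xs: "xs \<in> marked n"
  define c a where "c = closed_count xs" and "a = active_count xs"
  define F where "F ys = q powi pair_sum g ys * f (closed_count ys) (active_count ys)" for ys
  have len: "length xs = c + a"
    by (simp add: c_def a_def length_eq_closed_active)
  have "(\<Sum>b\<in>UNIV. F (insert_new (Suc n) (xs, p, b))) =
      q powi pair_sum g xs * q powi (d * int c) * (f c (Suc a) + f (Suc c) a) *
      q powi (l * int p + r * int (length xs - p))" if p: "p < Suc (length xs)" for p
  proof -
    have "closed_count (take p xs) + closed_count (drop p xs) = c"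
      "active_count (take p xs) + active_count (drop p xs) = a"
      unfolding c_def a_def by (simp_all flip: closed_count_simps(3) active_count_simps(3))
    then have cnt: "closed_count (insert_new (Suc n) (xs, p, b)) = c + of_bool b"
      "active_count (insert_new (Suc n) (xs, p, b)) = a + of_bool (\<not> b)" for b
      by (auto simp: insert_new_def)
    have "q powi pair_sum g (insert_new (Suc n) (xs, p, b)) =
        q powi pair_sum g xs * q powi (d * int c) * q powi (l * int p + r * int (length xs - p))" for b
      using pair_sum_insert_new[OF xs, of p b] p assms
      by (simp add: c_def power_int_add)
    then show ?thesis
      by (simp add: F_def cnt UNIV_bool algebra_simps)
  qed
  then have new: "(\<Sum>p<Suc (length xs). \<Sum>b\<in>UNIV. F (insert_new (Suc n) (xs, p, b))) =
      q powi pair_sum g xs * q powi (d * int c) * (f c (Suc a) + f (Suc c) a) *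
      geom q l r (Suc (c + a))"
    by (simp add: geom_def len sum_distrib_left del: sum.lessThan_Suc)
  have "(\<Sum>b\<in>UNIV. F (insert_into (Suc n) (xs, p, b))) =
      q powi pair_sum g xs * q powi (e * int c) * (f c a + f (Suc c) (a - 1)) *
      q powi (l' * int (active_count (take p xs)) + r' * int (active_count (drop (Suc p) xs)))"
    if p: "p < length xs" "\<not> snd (xs ! p)" for p
  proof -
    have "closed_count (take p xs @ xs ! p # drop (Suc p) xs) = c"
      "active_count (take p xs @ xs ! p # drop (Suc p) xs) = a"
      unfolding c_def a_def id_take_nth_drop[OF p(1), symmetric] by (rule refl)+
    then have "closed_count (take p xs) + closed_count (drop (Suc p) xs) = c"
      "active_count (take p xs) + active_count (drop (Suc p) xs) + 1 = a"
      using p(2) by simp_all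
    then have cnt: "closed_count (insert_into (Suc n) (xs, p, b)) = c + of_bool b"
      "active_count (insert_into (Suc n) (xs, p, b)) = (if b then a - 1 else a)" for b
      by (auto simp: insert_into_def)
    have "q powi pair_sum g (insert_into (Suc n) (xs, p, b)) =
        q powi pair_sum g xs * q powi (e * int c) *
        q powi (l' * int (active_count (take p xs)) + r' * int (active_count (drop (Suc p) xs)))" for b
      using pair_sum_insert_into[OF xs p, of b] assms
      by (simp add: c_def power_int_add)
    then show ?thesis
      by (simp add: F_def cnt UNIV_bool algebra_simps)
  qed
  then have "(\<Sum>p | p < length xs \<and> \<not> snd (xs ! p). \<Sum>b\<in>UNIV. F (insert_into (Suc n) (xs, p, b))) =
      q powi pair_sum g xs * q powi (e * int c) * (f c a + f (Suc c) (a - 1)) *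
      (\<Sum>p | p < length xs \<and> \<not> snd (xs ! p).
         q powi (l' * int (active_count (take p xs)) + r' * int (active_count (drop (Suc p) xs))))"
    by (simp add: sum_distrib_left)
  \<comment> \<open>Numbering the active blocks from left to right turns the sum over positions into
    a sum over \<open>{..<a}\<close>.\<close>
  also have "(\<Sum>p | p < length xs \<and> \<not> snd (xs ! p).
         q powi (l' * int (active_count (take p xs)) + r' * int (active_count (drop (Suc p) xs)))) =
      geom q l' r' a"
    unfolding active_count_def geom_def a_def
    by (rule sum_satisfying_positions[where P = "\<lambda>x. \<not> snd x"
          and h = "\<lambda>i j. q powi (l' * int i + r' * int j)"])
  finally have into: "(\<Sum>p | p < length xs \<and> \<not> snd (xs ! p). \<Sum>b\<in>UNIV. F (insert_into (Suc n) (xs, p, b))) =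
      q powi pair_sum g xs * q powi (e * int c) * (f c a + f (Suc c) (a - 1)) * geom q l' r' a" .
  show "(\<Sum>p<Suc (length xs). \<Sum>b\<in>UNIV.
           q powi pair_sum g (insert_new (Suc n) (xs, p, b)) *
             f (closed_count (insert_new (Suc n) (xs, p, b))) (active_count (insert_new (Suc n) (xs, p, b)))) +
        (\<Sum>p | p < length xs \<and> \<not> snd (xs ! p). \<Sum>b\<in>UNIV.
           q powi pair_sum g (insert_into (Suc n) (xs, p, b)) *
             f (closed_count (insert_into (Suc n) (xs, p, b))) (active_count (insert_into (Suc n) (xs, p, b)))) =
        q powi pair_sum g xs *
       (let c = closed_count xs; a = active_count xs in
          q powi (d * int c) * geom q l r (Suc (c + a)) * (f c (Suc a) + f (Suc c) a) +
          q powi (e * int c) * geom q l' r' a * (f c a + f (Suc c) (a - 1)))"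
    using new into unfolding F_def Let_def c_def[symmetric] a_def[symmetric]
    by (simp add: algebra_simps del: sum.lessThan_Suc)
qed

end

text \<open>Marking every block as closed is a bijection onto the marked lists without active
  blocks, the final states of the scan.\<close>

lemma sum_ordered_partitions_conv_marked:
  "(\<Sum>\<pi>\<in>ordered_partitions n k. F (map (\<lambda>B. (B, True)) \<pi>)) =
   (\<Sum>xs\<in>marked n. if closed_count xs = k \<and> active_count xs = 0 then F xs else (0::'a::comm_monoid_add))"
proof -
  have all: "active_count xs = 0 \<longleftrightarrow> map (\<lambda>B. (B, True)) (map fst xs) = xs" for xs
    by (induction xs) (auto simp: prod_eq_iff)
  have snd: "closed_count (map (\<lambda>B. (B, True)) \<pi>) = length \<pi>" for \<pi>
    by (induction \<pi>) auto
  have img: "(\<lambda>\<pi>. map (\<lambda>B. (B, True)) \<pi>) ` ordered_partitions n k =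
      {xs \<in> marked n. closed_count xs = k \<and> active_count xs = 0}"
  proof (intro equalityI subsetI)
    fix xs assume "xs \<in> (\<lambda>\<pi>. map (\<lambda>B. (B, True)) \<pi>) ` ordered_partitions n k"
    then obtain \<pi> where \<pi>: "\<pi> \<in> ordered_partitions n k" "xs = map (\<lambda>B. (B, True)) \<pi>"
      by blast
    moreover have "length \<pi> = k"
      using \<pi>(1) by (simp add: ordered_partitions_def)
    ultimately show "xs \<in> {xs \<in> marked n. closed_count xs = k \<and> active_count xs = 0}"
      using snd all[of xs] by (simp add: marked_def comp_def)
  next
    fix xs assume xs: "xs \<in> {xs \<in> marked n. closed_count xs = k \<and> active_count xs = 0}"
    then have "map fst xs \<in> ordered_partitions n k"
      by (auto simp: marked_def length_eq_closed_active)
    then show "xs \<in> (\<lambda>\<pi>. map (\<lambda>B. (B, True)) \<pi>) ` ordered_partitions n k"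
      using xs all[of xs] by (intro image_eqI[of _ _ "map fst xs"]) auto
  qed
  have "inj_on (\<lambda>\<pi>. map (\<lambda>B. (B, True)) \<pi>) (ordered_partitions n k)"
    by (rule inj_on_subset[OF inj_mapI]) (auto intro: injI)
  then have "(\<Sum>\<pi>\<in>ordered_partitions n k. F (map (\<lambda>B. (B, True)) \<pi>)) =
      (\<Sum>xs\<in>{xs \<in> marked n. closed_count xs = k \<and> active_count xs = 0}. F xs)"
    by (simp add: sum.reindex flip: img)
  then show ?thesis
    by (simp only: sum.inter_filter[OF finite_marked])
qed

section \<open>The scan as a weighted lattice walk\<close>

text \<open>The q-Stirling number of the second kind with the factor \<open>q ^ (m choose 2)\<close>
  removed.\<close>

fun stirling_low :: "'a::comm_ring_1 \<Rightarrow> nat \<Rightarrow> nat \<Rightarrow> 'a" where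
  "stirling_low q 0 m = of_bool (m = 0)"
| "stirling_low q (Suc n) m =
     (if m = 0 then 0 else stirling_low q n (m - 1)) + q_int q m * stirling_low q n m"

section \<open>q-integers and geometric sums\<close>

lemma q_int_0 [simp]: "q_int q 0 = 0"
  by (simp add: q_int_def)

lemma q_int_Suc: "q_int q (Suc n) = q_int q n + q ^ n"
  by (simp add: q_int_def)

lemma q_int_add: "q_int q (m + n) = q_int q m + q ^ m * q_int q n"
  by (induction n) (simp_all add: q_int_Suc algebra_simps power_add)

lemma q_fact_0 [simp]: "q_fact q 0 = 1"
  by (simp add: q_fact_def)

lemma q_fact_Suc: "q_fact q (Suc n) = q_int q (Suc n) * q_fact q n"
  by (simp add: q_fact_def mult.commute)

lemma Suc_choose_two: "Suc k choose 2 = k + (k choose 2)"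
  by (simp add: numeral_2_eq_2)

lemma zero_choose_two [simp]: "0 choose 2 = 0"
  by (simp add: numeral_2_eq_2)

text \<open>The factors \<open>q ^ k\<close> in the recurrence accumulate to the exponent
  \<open>0 + 1 + ... + (k - 1) = k choose 2\<close>.\<close>

lemma q_stirling_conv_low: "q_stirling q n k = q ^ (k choose 2) * stirling_low q n k"
proof (induction q n k rule: q_stirling.induct)
  case (4 q n k)
  then show ?case
    by (simp add: Suc_choose_two power_add algebra_simps)
qed simp_all

lemma geom_0 [simp]: "geom q x y 0 = 0"
  by (simp add: geom_def)

text \<open>The row of places is read from right to left. This symmetry is why adding or subtracting
  \<open>inv - cinv\<close> can leave the generating function unchanged.\<close>

lemma geom_swap: "geom q x y N = geom q y x N"
proof -
  have "geom q x y N = (\<Sum>j<N. q powi (x * int (N - Suc j) + y * int (N - Suc (N - Suc j))))"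
    unfolding geom_def by (rule sum.nat_diff_reindex[symmetric])
  also have "\<dots> = geom q y x N"
    unfolding geom_def by (intro sum.cong refl) (auto simp: Suc_diff_Suc add.commute)
  finally show ?thesis .
qed

lemma geom_1_0: "geom q 1 0 N = q_int q N"
  by (simp add: geom_def q_int_def)

text \<open>The exponents run through \<open>1 - N, ..., 0\<close>, and the lowest power is factored
  out.\<close>

lemma geom_minus_1_0:
  assumes "q \<noteq> 0"
  shows "geom q (-1) 0 N = q powi (1 - int N) * q_int q N"
proof -
  have "geom q (-1) 0 N = geom q 0 (-1) N"
    by (rule geom_swap)
  also have "\<dots> = (\<Sum>j<N. q powi (1 - int N) * q ^ j)"
    unfolding geom_def
  proof (intro sum.cong refl)
    fix j assume "j \<in> {..<N}"
    then have "0 * int j + -1 * int (N - Suc j) = (1 - int N) + int j"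
      by auto
    then show "q powi (0 * int j + -1 * int (N - Suc j)) = q powi (1 - int N) * q ^ j"
      by (simp only: power_int_add[OF disjI1[OF assms]] power_int_of_nat)
  qed
  finally show ?thesis
    by (simp add: q_int_def sum_distrib_left)
qed

section \<open>The walk of the numbers of closed and active blocks\<close>

context scan_stat
begin

text \<open>The total weight of the walks with \<open>n\<close> steps from \<open>(0, 0)\<close> to
  \<open>(c, a)\<close>.\<close>

definition weight_sum :: "'a::field \<Rightarrow> nat \<Rightarrow> nat \<Rightarrow> nat \<Rightarrow> 'a" where
  "weight_sum q n c a =
     (\<Sum>xs\<in>marked n. q powi pair_sum g xs * of_bool (closed_count xs = c \<and> active_count xs = a))"

text \<open>The weight of a step out of \<open>(c, a)\<close> that opens a block, summed over all
  gaps with the mark fixed. \<open>into_weight\<close> is the analogue for joining an active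
  block.\<close>

definition new_weight :: "'a::field \<Rightarrow> nat \<Rightarrow> nat \<Rightarrow> 'a" where
  "new_weight q c a = q powi (d * int c) * geom q l r (Suc (c + a))"

definition into_weight :: "'a::field \<Rightarrow> nat \<Rightarrow> nat \<Rightarrow> 'a" where
  "into_weight q c a = q powi (e * int c) * geom q l' r' a"

lemma sum_ordered_partitions_conv_weight_sum:
  "(\<Sum>\<pi>\<in>ordered_partitions n k. q powi pair_sum g (map (\<lambda>B. (B, True)) \<pi>)) = weight_sum q n k 0"
  unfolding sum_ordered_partitions_conv_marked[of "\<lambda>xs. q powi pair_sum g xs"] weight_sum_def
  by (intro sum.cong) auto

lemma weight_sum_0: "weight_sum q 0 c a = of_bool (c = 0 \<and> a = 0)"
  by (simp add: weight_sum_def marked_0)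

text \<open>The four terms are the four ways to arrive at \<open>(c, a)\<close>: a new block kept
  active, a new block closed at once, an active block joined and kept active, an active block joined
  and closed.\<close>

lemma weight_sum_Suc:
  fixes q :: "'a::field"
  assumes "q \<noteq> 0"
  shows "weight_sum q (Suc n) c a =
    (if a = 0 then 0 else new_weight q c (a - 1) * weight_sum q n c (a - 1)) +
    (if c = 0 then 0 else new_weight q (c - 1) a * weight_sum q n (c - 1) a) +
    into_weight q c a * weight_sum q n c a +
    (if c = 0 then 0 else into_weight q (c - 1) (Suc a) * weight_sum q n (c - 1) (Suc a))"
proof -
  define z :: "nat \<Rightarrow> nat \<Rightarrow> mblock list \<Rightarrow> 'a" where
    "z c a xs = q powi pair_sum g xs * of_bool (closed_count xs = c \<and> active_count xs = a)" for c a xs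
  have "weight_sum q (Suc n) c a = (\<Sum>xs\<in>marked n.
    (if a = 0 then 0 else new_weight q c (a - 1) * z c (a - 1) xs) +
    (if c = 0 then 0 else new_weight q (c - 1) a * z (c - 1) a xs) +
    into_weight q c a * z c a xs +
    (if c = 0 then 0 else into_weight q (c - 1) (Suc a) * z (c - 1) (Suc a) xs))"
    unfolding weight_sum_def sum_marked_scan[OF assms, of "\<lambda>c' a'. of_bool (c' = c \<and> a' = a)"]
  proof (intro sum.cong refl)
    fix xs assume "xs \<in> marked n"
    show "q powi pair_sum g xs *
       (let c' = closed_count xs; a' = active_count xs in
          q powi (d * int c') * geom q l r (Suc (c' + a')) *
            (of_bool (c' = c \<and> Suc a' = a) + of_bool (Suc c' = c \<and> a' = a)) +
          q powi (e * int c') * geom q l' r' a' *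
            (of_bool (c' = c \<and> a' = a) + of_bool (Suc c' = c \<and> a' - 1 = a))) =
    (if a = 0 then 0 else new_weight q c (a - 1) * z c (a - 1) xs) +
    (if c = 0 then 0 else new_weight q (c - 1) a * z (c - 1) a xs) +
    into_weight q c a * z c a xs +
    (if c = 0 then 0 else into_weight q (c - 1) (Suc a) * z (c - 1) (Suc a) xs)"
      unfolding z_def
      \<comment> \<open>If no block is active, the truncated \<open>a' - 1\<close> names a wrong
        state, but the factor \<open>geom q l' r' 0\<close> removes that term.\<close>
      by (cases a; cases c; cases "active_count xs")
        (auto simp: Let_def new_weight_def into_weight_def algebra_simps)
  qed
  then show ?thesis
    unfolding z_def weight_sum_def by (simp add: sum.distrib sum_distrib_left)
qed

end

section \<open>Closed forms for the walk sums\<close>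

locale generic_q =
  fixes q :: "'a::field"
  assumes q_nonzero: "q \<noteq> 0" and q_int_nonzero: "n > 0 \<Longrightarrow> q_int q n \<noteq> 0"
begin

lemma q_fact_nonzero: "q_fact q n \<noteq> 0"
  by (induction n) (auto simp: q_fact_Suc q_int_nonzero)

text \<open>\<open>[c + a]!\<close> times the q-binomial coefficient of \<open>c + a\<close> over
  \<open>c\<close>.\<close>

definition walk_coeff :: "nat \<Rightarrow> nat \<Rightarrow> 'a" where
  "walk_coeff c a = q_fact q (c + a) ^ 2 / (q_fact q c * q_fact q a)"

text \<open>This and the next two lemmas express the coefficient of a predecessor through that of
  the state reached, for opening an active block, opening a block closed at once, and closing an
  active block.\<close>

lemma walk_coeff_Suc_active:
  "q_int q (c + Suc a) * walk_coeff c a = q_int q (Suc a) * walk_coeff c (Suc a) / q_int q (c + Suc a)"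
  using q_int_nonzero[of "Suc a"] q_int_nonzero[of "c + Suc a"] q_fact_nonzero
  by (simp add: walk_coeff_def q_fact_Suc power2_eq_square)

lemma walk_coeff_Suc_closed:
  "q_int q (Suc c + a) * walk_coeff c a = q_int q (Suc c) * walk_coeff (Suc c) a / q_int q (Suc c + a)"
  using q_int_nonzero[of "Suc c"] q_int_nonzero[of "Suc c + a"] q_fact_nonzero
  by (simp add: walk_coeff_def q_fact_Suc power2_eq_square)

lemma walk_coeff_close:
  "q_int q (Suc a) * walk_coeff c (Suc a) = q_int q (Suc c) * walk_coeff (Suc c) a"
  using q_int_nonzero[of "Suc c"] q_int_nonzero[of "Suc a"] q_fact_nonzero
  by (simp add: walk_coeff_def q_fact_Suc)

end

locale generic_scan = generic_q q + scan_stat g d l r e l' r'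
  for q :: "'a::field" and g d l r e l' r'
begin

text \<open>\<open>E c a\<close> is the normalising power of \<open>q\<close>; the last two assumptions say that both coefficients
  in the recurrence of the walk collapse by \<open>[c + a] = [c] + q\<^bsup>c\<^esup>[a]\<close> or its mirror image.\<close>

lemma weight_sum_closed_form:
  fixes E x y :: "nat \<Rightarrow> nat \<Rightarrow> 'a"
  assumes new: "\<And>c a. new_weight q c a = x c a * q_int q (Suc (c + a))"
    and into: "\<And>c a. into_weight q c a = y c a * q_int q a"
    and E0: "E 0 0 = 1"
    and new_E: "\<And>c a. (if a = 0 then 0 else x c (a - 1) * E c (a - 1) * q_int q a) +
      (if c = 0 then 0 else x (c - 1) a * E (c - 1) a * q_int q c) = E c a * q_int q (c + a)"
    and into_E: "\<And>c a. y c a * E c a * q_int q a +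
      (if c = 0 then 0 else y (c - 1) (Suc a) * E (c - 1) (Suc a) * q_int q c) =
      E c a * q_int q (c + a)"
  shows "weight_sum q n c a = E c a * walk_coeff c a * stirling_low q n (c + a)"
proof (induction n arbitrary: c a)
  case 0
  then show ?case
    using E0 by (auto simp: weight_sum_0 walk_coeff_def)
next
  case (Suc n)
  let ?m = "c + a"
  \<comment> \<open>Each of the four terms becomes a summand of \<open>new_E\<close> or
    \<open>into_E\<close> times a factor common to the opening or to the joining terms.\<close>
  have new_a: "(if a = 0 then 0 else new_weight q c (a - 1) * weight_sum q n c (a - 1)) =
      (if a = 0 then 0 else x c (a - 1) * E c (a - 1) * q_int q a) *
        (walk_coeff c a / q_int q ?m * stirling_low q n (?m - 1))"
  proof (cases a)
    case (Suc a')
    have "new_weight q c a' * weight_sum q n c a' =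
        x c a' * E c a' * (q_int q (c + Suc a') * walk_coeff c a') * stirling_low q n (c + a')"
      by (simp add: new Suc.IH algebra_simps)
    then show ?thesis
      unfolding walk_coeff_Suc_active by (simp add: Suc)
  qed simp
  have new_c: "(if c = 0 then 0 else new_weight q (c - 1) a * weight_sum q n (c - 1) a) =
      (if c = 0 then 0 else x (c - 1) a * E (c - 1) a * q_int q c) *
        (walk_coeff c a / q_int q ?m * stirling_low q n (?m - 1))"
  proof (cases c)
    case (Suc c')
    have "new_weight q c' a * weight_sum q n c' a =
        x c' a * E c' a * (q_int q (Suc c' + a) * walk_coeff c' a) * stirling_low q n (c' + a)"
      by (simp add: new Suc.IH algebra_simps)
    then show ?thesis
      unfolding walk_coeff_Suc_closed by (simp add: Suc)
  qed simp
  have into_a: "into_weight q c a * weight_sum q n c a =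
      y c a * E c a * q_int q a * (walk_coeff c a * stirling_low q n ?m)"
    by (simp add: into Suc.IH)
  have into_c: "(if c = 0 then 0 else into_weight q (c - 1) (Suc a) * weight_sum q n (c - 1) (Suc a)) =
      (if c = 0 then 0 else y (c - 1) (Suc a) * E (c - 1) (Suc a) * q_int q c) *
        (walk_coeff c a * stirling_low q n ?m)"
  proof (cases c)
    case (Suc c')
    have "into_weight q c' (Suc a) * weight_sum q n c' (Suc a) =
        y c' (Suc a) * E c' (Suc a) * (q_int q (Suc a) * walk_coeff c' (Suc a)) *
          stirling_low q n (c' + Suc a)"
      by (simp add: into Suc.IH algebra_simps)
    then show ?thesis
      unfolding walk_coeff_close by (simp add: Suc)
  qed simp
  \<comment> \<open>The two opening and the two joining terms are paired, so that
    \<open>new_E\<close> and \<open>into_E\<close> apply to the brackets.\<close>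
  have "A * u + B * u + C * v + D * v = (A + B) * u + (C + D) * v" for A B C D u v :: 'a
    by (simp only: distrib_right add.assoc)
  then have "weight_sum q (Suc n) c a =
      E c a * q_int q ?m * (walk_coeff c a / q_int q ?m * stirling_low q n (?m - 1)) +
      E c a * q_int q ?m * (walk_coeff c a * stirling_low q n ?m)"
    unfolding weight_sum_Suc[OF q_nonzero] new_a new_c into_a into_c new_E[symmetric, of c a]
    by (simp only: into_E new_E)
  \<comment> \<open>After \<open>q_int q ?m\<close> cancels in the first term, this is the
    recurrence of \<open>stirling_low\<close>; for \<open>?m = 0\<close> both sides vanish.\<close>
  also have "\<dots> = E c a * walk_coeff c a * stirling_low q (Suc n) ?m"
  proof (cases "?m = 0")
    case False
    then show ?thesis
      using q_int_nonzero[of ?m] by (auto simp: field_simps)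
  qed simp
  finally show ?case .
qed

lemma weight_sum_closed_form_final:
  assumes "weight_sum q n k 0 = E * walk_coeff k 0 * stirling_low q n k"
  shows "weight_sum q n k 0 = E * q_fact q k * stirling_low q n k"
  using assms q_fact_nonzero[of k] by (simp add: walk_coeff_def power2_eq_square)

text \<open>Here \<open>E c a = q ^ (c choose 2)\<close>. Since \<open>c choose 2\<close> exceeds
  \<open>c - 1 choose 2\<close> by \<open>c - 1\<close>, both conditions on \<open>E\<close> become
  \<open>[c + a] = [c] + q ^ c * [a]\<close>.\<close>

lemma weight_sum_mak_type:
  assumes new: "\<And>c a. new_weight q c a = q ^ c * q_int q (Suc (c + a))"
    and into: "\<And>c a. into_weight q c a = q ^ c * q_int q a"
  shows "weight_sum q n k 0 = q_fact q k * q_stirling q n k"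
proof -
  have "weight_sum q n c a = q ^ (c choose 2) * walk_coeff c a * stirling_low q n (c + a)" for c a
  proof (rule weight_sum_closed_form[OF new into])
    fix c a
    show "(if a = 0 then 0 else q ^ c * q ^ (c choose 2) * q_int q a) +
        (if c = 0 then 0 else q ^ (c - 1) * q ^ (c - 1 choose 2) * q_int q c) =
        q ^ (c choose 2) * q_int q (c + a)"
      using q_int_add[of q c a] by (cases c) (auto simp: Suc_choose_two power_add algebra_simps)
    show "q ^ c * q ^ (c choose 2) * q_int q a +
        (if c = 0 then 0 else q ^ (c - 1) * q ^ (c - 1 choose 2) * q_int q c) =
        q ^ (c choose 2) * q_int q (c + a)"
      using q_int_add[of q c a] by (cases c) (auto simp: Suc_choose_two power_add algebra_simps)
  qed simp
  from weight_sum_closed_form_final[of n k, OF this[of k 0, simplified]] show ?thesis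
    by (simp add: q_stirling_conv_low)
qed

text \<open>Both conditions on \<open>E\<close> reduce to the mirror image
  \<open>[a + c] = [a] + q ^ a * [c]\<close>. The prefactor turns the final power
  \<open>E k 0\<close>, of exponent \<open>- (k choose 2)\<close>, into the one separating
  \<open>q_stirling\<close> from \<open>stirling_low\<close>.\<close>

lemma weight_sum_lsb_type:
  assumes new: "\<And>c a. new_weight q c a = q powi - int c * q_int q (Suc (c + a))"
    and into: "\<And>c a. into_weight q c a = 1 * q_int q a"
  shows "q powi (2 * int (k choose 2)) * weight_sum q n k 0 = q_fact q k * q_stirling q n k"
proof -
  \<comment> \<open>The exponent is read off from the steps: opening an active block divides by
    \<open>q ^ c\<close>, opening a closed one by \<open>q ^ (a + c)\<close>.\<close>
  define E where "E c a = q powi - int (a * c + (c choose 2))" for c a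
  have E: "q powi - int c * E c a = E c (Suc a)" "q powi - int c * E c a = q ^ a * E (Suc c) a"
    "E c (Suc a) = q ^ a * E (Suc c) a" for c a
    using q_nonzero unfolding E_def
    by (simp_all flip: power_int_of_nat power_int_add add: Suc_choose_two algebra_simps)
  have "weight_sum q n c a = E c a * walk_coeff c a * stirling_low q n (c + a)" for c a
  proof (rule weight_sum_closed_form[OF new into])
    fix c a
    have comm: "q_int q (c + a) = q_int q a + q ^ a * q_int q c"
      using q_int_add[of q a c] by (simp add: add.commute)
    have A: "(if a = 0 then 0 else q powi - int c * E c (a - 1) * q_int q a) = E c a * q_int q a"
      by (cases a) (simp_all add: E(1))
    have C: "(if c = 0 then 0 else q powi - int (c - 1) * E (c - 1) a * q_int q c) =
        q ^ a * E c a * q_int q c"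
      by (cases c) (simp_all add: E(2))
    show "(if a = 0 then 0 else q powi - int c * E c (a - 1) * q_int q a) +
        (if c = 0 then 0 else q powi - int (c - 1) * E (c - 1) a * q_int q c) =
        E c a * q_int q (c + a)"
      unfolding A C comm by (simp add: algebra_simps)
    have D: "(if c = 0 then 0 else 1 * E (c - 1) (Suc a) * q_int q c) = q ^ a * E c a * q_int q c"
      by (cases c) (simp_all add: E(3))
    show "1 * E c a * q_int q a + (if c = 0 then 0 else 1 * E (c - 1) (Suc a) * q_int q c) =
        E c a * q_int q (c + a)"
      unfolding D comm by (simp add: algebra_simps)
  qed (simp add: E_def)
  from weight_sum_closed_form_final[of n k, OF this[of k 0, simplified]]
  have "weight_sum q n k 0 = q powi - int (k choose 2) * q_fact q k * stirling_low q n k"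
    by (simp add: E_def)
  moreover have "q powi (2 * int (k choose 2)) * q powi - int (k choose 2) = q ^ (k choose 2)"
    using q_nonzero by (simp flip: power_int_add power_int_of_nat)
  ultimately show ?thesis
    by (simp add: q_stirling_conv_low mult.assoc[symmetric]) 
qed

text \<open>For \<open>lmak\<close> the partial sums have no product form; instead, the sum over all completions
  of a state \<open>(c, a)\<close> by \<open>s\<close> further elements has one, and it is given by this function.\<close>

definition completion :: "nat \<Rightarrow> nat \<Rightarrow> nat \<Rightarrow> nat \<Rightarrow> 'a" where
  "completion k s c a = (if c + a \<le> k
     then q powi (int (k - (c + a) choose 2) - int s * (int k - 1)) *
       (q_fact q k * q_fact q (k - c) / (q_fact q (c + a) * q_fact q (k - (c + a)))) *
       stirling_low q s (k - c)
     else 0)"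

text \<open>With no step left, \<open>stirling_low q 0 (k - c)\<close> forces \<open>c = k\<close>,
  and then \<open>c + a \<le> k\<close> forces \<open>a = 0\<close>.\<close>

lemma completion_0: "completion k 0 c a = of_bool (c = k \<and> a = 0)"
  using q_fact_nonzero by (auto simp: completion_def)

text \<open>The first remaining step is singled out. There are \<open>u = k - (c + a)\<close> blocks
  still to be opened and \<open>k - c = a + u\<close> still to be closed. Opening yields
  \<open>[u]\<close>, joining yields \<open>q ^ u * [a]\<close>, and their sum
  \<open>[a + u]\<close> leads to the recurrence of \<open>stirling_low\<close>.\<close>

lemma completion_Suc:
  assumes new: "\<And>c a. new_weight q c a = q powi - int (c + a) * q_int q (Suc (c + a))"
    and into: "\<And>c a. into_weight q c a = q powi (1 - int (c + a)) * q_int q a"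
  shows "completion k (Suc s) c a =
    new_weight q c a * (completion k s c (Suc a) + completion k s (Suc c) a) +
    into_weight q c a * (completion k s c a + completion k s (Suc c) (a - 1))"
\<comment> \<open>Outside this range every term vanishes: there are more than \<open>k\<close>
  blocks, or all \<open>k\<close> blocks are closed.\<close>
proof (cases "c + a \<le> k \<and> c < k")
  case False
  then consider "c + a > k" | "c = k" "a = 0"
    by fastforce
  then show ?thesis
  proof cases
    case 1
    then show ?thesis
      by (cases a) (auto simp: completion_def into)
  next
    case 2
    then show ?thesis
      by (auto simp: completion_def into)
  qed
next
  case True
  define u where "u = k - (c + a)"
  have k: "k = c + a + u" and "a + u > 0"
    using True by (auto simp: u_def)
  then obtain K where K: "a + u = Suc K"
    by (metis gr0_implies_Suc)
  \<comment> \<open>\<open>X\<close> is the prefactor of \<open>completion k s c a\<close>, and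
    \<open>?Q\<close> is the power contributed by one more step.\<close>
  define X where "X = q powi (int (u choose 2) - int s * (int k - 1)) *
      (q_fact q k * q_fact q (Suc K) / (q_fact q (c + a) * q_fact q u))"
  let ?Q = "q powi - (int k - 1)"
  have kc: "k - c = Suc K" "k - Suc c = K"
    using k K by auto
  note nz = q_nonzero q_fact_nonzero q_int_nonzero
  have lhs: "completion k (Suc s) c a =
      ?Q * X * (stirling_low q s K + q_int q (Suc K) * stirling_low q s (Suc K))"
  proof -
    have "q powi (int (u choose 2) - int (Suc s) * (int k - 1)) =
        ?Q * q powi (int (u choose 2) - int s * (int k - 1))"
      using q_nonzero by (simp flip: power_int_add) (simp add: algebra_simps)
    then show ?thesis
      using True by (simp add: completion_def X_def kc flip: u_def)
  qed
  have new1: "new_weight q c a * completion k s c (Suc a) = ?Q * X * (q_int q u * stirling_low q s (Suc K))"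
   and new2: "new_weight q c a * completion k s (Suc c) a =
      ?Q * X * (q_int q u / q_int q (Suc K) * stirling_low q s K)"
  proof -
    have "new_weight q c a * completion k s c (Suc a) = ?Q * X * (q_int q u * stirling_low q s (Suc K))
      \<and> new_weight q c a * completion k s (Suc c) a =
      ?Q * X * (q_int q u / q_int q (Suc K) * stirling_low q s K)"
    \<comment> \<open>For \<open>u = 0\<close> no further block may open: the completions on the
      left vanish, as does \<open>q_int q u\<close> on the right.\<close>
    proof (cases u)
      case 0
      then show ?thesis
        using k by (simp add: completion_def)
    next
      case (Suc u')
      have le: "Suc (c + a) \<le> k" "k - Suc (c + a) = u'"
        using k Suc by auto
      \<comment> \<open>\<open>u choose 2\<close> exceeds \<open>u' choose 2\<close> by
        \<open>u' = k - 1 - (c + a)\<close>, which balances the powers in front.\<close>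
      have "q powi - int (c + a) * q powi (int (u' choose 2) - int s * (int k - 1)) =
          ?Q * q powi (int (u choose 2) - int s * (int k - 1))"
        using q_nonzero by (simp flip: power_int_add add: k Suc Suc_choose_two algebra_simps)
      then have pw: "q powi - int (c + a) * (q powi (int (u' choose 2) - int s * (int k - 1)) * z) =
          ?Q * q powi (int (u choose 2) - int s * (int k - 1)) * z" for z
        by (simp add: mult.assoc[symmetric])
      show ?thesis
        using le nz(2) nz(3)[of "Suc u'"] nz(3)[of "Suc K"] nz(3)[of "Suc (c + a)"] pw
        by (simp add: new completion_def X_def kc mult.assoc mult.left_commute[of "q_int q _" "q powi _"])
          (simp add: Suc q_fact_Suc field_simps)
    qed
    then show "new_weight q c a * completion k s c (Suc a) = ?Q * X * (q_int q u * stirling_low q s (Suc K))"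
      "new_weight q c a * completion k s (Suc c) a =
      ?Q * X * (q_int q u / q_int q (Suc K) * stirling_low q s K)"
      by auto
  qed
  have Q: "q powi (1 - int (c + a)) = ?Q * q ^ u"
  proof -
    have "1 - int (c + a) = - (int k - 1) + int u"
      by (simp add: k)
    then show ?thesis
      by (simp only: power_int_add[OF disjI1[OF q_nonzero]] power_int_of_nat)
  qed
  have into1: "into_weight q c a * completion k s c a =
      ?Q * X * (q ^ u * q_int q a * stirling_low q s (Suc K))"
    using True unfolding into Q by (simp add: completion_def X_def kc flip: u_def)
  have into2: "into_weight q c a * completion k s (Suc c) (a - 1) =
      ?Q * X * (q ^ u * q_int q a / q_int q (Suc K) * stirling_low q s K)"
  proof (cases a)
    case (Suc a')
    have "completion k s (Suc c) a' = X / q_int q (Suc K) * stirling_low q s K"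
      using True nz(2) nz(3)[of "Suc K"] Suc kc
      by (simp add: completion_def X_def u_def q_fact_Suc)
    then show ?thesis
      unfolding into Q by (simp add: Suc)
  qed (simp add: into)
  have "q_int q u + q ^ u * q_int q a = q_int q (Suc K)"
    using q_int_add[of q u a] K by (simp add: add.commute)
  moreover from this have "q_int q u / q_int q (Suc K) + q ^ u * q_int q a / q_int q (Suc K) = 1"
    using nz(3)[of "Suc K"] by (simp flip: add_divide_distrib)
  \<comment> \<open>The terms are regrouped by the two values of \<open>stirling_low\<close> instead
    of by the kind of step.\<close>
  moreover have "P * (w1 * S) + P * (w2 * T) + (P * (w3 * S) + P * (w4 * T)) =
      P * ((w2 + w4) * T + (w1 + w3) * S)" for P w1 w2 w3 w4 S T :: 'a
    by (simp add: algebra_simps)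
  ultimately show ?thesis
    unfolding lhs distrib_left[of "new_weight q c a"] distrib_left[of "into_weight q c a"]
      new1 new2 into1 into2
    by (simp only: mult_1_left)
qed

text \<open>The sum of weights times completions depends only on \<open>n + s\<close>, because
  \<open>completion_Suc\<close> moves one step across the split. Without remaining steps it is
  \<open>weight_sum q n k 0\<close>; without scanned elements it is
  \<open>completion k n 0 0\<close>.\<close>

lemma weight_sum_lmak_type:
  assumes new: "\<And>c a. new_weight q c a = q powi - int (c + a) * q_int q (Suc (c + a))"
    and into: "\<And>c a. into_weight q c a = q powi (1 - int (c + a)) * q_int q a"
  shows "q powi (int n * (int k - 1)) * weight_sum q n k 0 = q_fact q k * q_stirling q n k"
proof -
  have "(\<Sum>xs\<in>marked n. q powi pair_sum g xs * completion k s (closed_count xs) (active_count xs)) =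
      completion k (n + s) 0 0" for s
  proof (induction n arbitrary: s)
    case 0
    then show ?case by (simp add: marked_0)
  next
    case (Suc n)
    show ?case
      using Suc[of "Suc s"]
      unfolding sum_marked_scan[OF q_nonzero] completion_Suc[OF new into]
      by (simp add: Let_def new_weight_def into_weight_def)
  qed
  from this[of 0] have "weight_sum q n k 0 = completion k n 0 0"
    by (simp add: weight_sum_def completion_0)
  also have "\<dots> = q powi (int (k choose 2) - int n * (int k - 1)) * q_fact q k * stirling_low q n k"
    using q_fact_nonzero[of k] by (simp add: completion_def)
  finally have W: "weight_sum q n k 0 =
      q powi (int (k choose 2) - int n * (int k - 1)) * q_fact q k * stirling_low q n k" .
  have "q powi (int n * (int k - 1)) * q powi (int (k choose 2) - int n * (int k - 1)) =
      q ^ (k choose 2)"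
    using q_nonzero by (simp flip: power_int_add power_int_of_nat)
  then show ?thesis
    unfolding W by (simp add: q_stirling_conv_low mult.assoc[symmetric])
qed

end

section \<open>The statistics as pair sums\<close>

definition above :: "nat set \<Rightarrow> nat \<Rightarrow> int" where
  "above A x = int (card {i \<in> A. x < i})"

text \<open>The condition waits until \<open>y\<close> is closed, since later elements would raise
  its maximum. The minimum of \<open>x\<close> is final at once, as elements arrive in increasing
  order.\<close>

definition block_inversion :: "mblock \<Rightarrow> mblock \<Rightarrow> int" where
  "block_inversion x y = of_bool (snd y \<and> Max (fst y) < Min (fst x))"

text \<open>The summands stem from \<open>ros\<close>, \<open>lcs\<close> and \<open>bInv\<close>; a
  maximum counts as a closer only once its block is closed.\<close>

definition mak_pair :: "mblock \<Rightarrow> mblock \<Rightarrow> int" where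
  "mak_pair x y = above (fst x) (Min (fst y)) + of_bool (snd x) * above (fst y) (Max (fst x)) +
     block_inversion x y"

definition lmak_pair :: "mblock \<Rightarrow> mblock \<Rightarrow> int" where
  "lmak_pair x y = - above (fst y) (Min (fst x)) - of_bool (snd y) * above (fst x) (Max (fst y)) +
     block_inversion x y"

text \<open>For an active \<open>x\<close> the upper bound is dropped: its maximum is still to come
  and will exceed every element present.\<close>

definition lsb_pair :: "mblock \<Rightarrow> mblock \<Rightarrow> int" where
  "lsb_pair x y =
     int (card {i \<in> fst y. Min (fst x) < i \<and> (snd x \<longrightarrow> i < Max (fst x))}) - block_inversion x y"

text \<open>The pair sum of this function is \<open>inv - cinv\<close>.\<close>

definition inv_pair :: "mblock \<Rightarrow> mblock \<Rightarrow> int" where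
  "inv_pair x y = 2 * of_bool (Min (fst y) < Min (fst x)) - 1"

section \<open>Response of the pair functions to a new maximum\<close>

lemma above_insert:
  assumes "finite X" "\<forall>i\<in>X. i < N" "m < N"
  shows "above (insert N X) m = above X m + 1"
proof -
  have "{i \<in> insert N X. m < i} = insert N {i \<in> X. m < i}" "N \<notin> {i \<in> X. m < i}"
    using assms by auto
  then show ?thesis
    using assms(1) by (simp add: above_def)
qed

lemma above_eq_0: "\<forall>i\<in>X. i \<le> m \<Longrightarrow> above X m = 0"
  unfolding above_def by (metis (mono_tags, lifting) Collect_empty_eq card.empty leD of_nat_0)

lemma above_singleton: "m < N \<Longrightarrow> above {N} m = 1"
  using above_insert[of "{}" N m] by (simp add: above_eq_0)

lemma Min_less_bound: "finite A \<Longrightarrow> A \<noteq> {} \<Longrightarrow> \<forall>i\<in>A. i < (N::nat) \<Longrightarrow> Min A < N"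
  by simp

lemma Max_less_bound: "finite A \<Longrightarrow> A \<noteq> {} \<Longrightarrow> \<forall>i\<in>A. i < (N::nat) \<Longrightarrow> Max A < N"
  by simp

lemma Min_insert_bound:
  "finite A \<Longrightarrow> A \<noteq> {} \<Longrightarrow> \<forall>i\<in>A. i < (N::nat) \<Longrightarrow> Min (insert N A) = Min A"
  by (simp add: min_absorb2 less_imp_le)

lemma Max_insert_bound:
  "finite A \<Longrightarrow> A \<noteq> {} \<Longrightarrow> \<forall>i\<in>A. i < (N::nat) \<Longrightarrow> Max (insert N A) = N"
  by (simp add: max_absorb1 less_imp_le)

lemmas bound_simps = Min_less_bound Max_less_bound Min_insert_bound Max_insert_bound

lemma block_inversion_simps:
  assumes "finite A" "A \<noteq> {}" "\<forall>i\<in>A. i < N" and "finite X" "X \<noteq> {}" "\<forall>i\<in>X. i < N"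
  shows "block_inversion (A, s) ({N}, b) = 0"
    and "block_inversion ({N}, b) (A, s) = of_bool s"
    and "block_inversion (A, s) (insert N X, b) = 0"
    and "block_inversion (A, s) (X, False) = 0"
    and "block_inversion (insert N X, b) (A, s) = block_inversion (X, False) (A, s)"
  using bound_simps[OF assms(1-3)] bound_simps[OF assms(4-6)]
  by (auto simp: block_inversion_def simp del: Min_insert Max_insert)

lemma above_upper_bound:
  "\<forall>i\<in>A. i < N \<Longrightarrow> above A N = 0"
  by (intro above_eq_0) auto

text \<open>Beside a new block, a closed block adds the surplus \<open>d = 1\<close> on either side:
  through \<open>lcs\<close> from the left, through \<open>bInv\<close> from the right.\<close>

interpretation mak_scan: scan_stat mak_pair 1 0 1 1 0 1
proof
  fix A X :: "nat set" and s b :: bool and N :: nat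
  assume A: "finite A" "A \<noteq> {}" "\<forall>i\<in>A. i < N"
  note b = bound_simps[OF A]
  show "mak_pair (A, s) ({N}, b) = 1 * of_bool s + 0"
    using block_inversion_simps[OF A A] b
    by (simp add: mak_pair_def above_upper_bound[OF A(3)] above_singleton)
  show "mak_pair ({N}, b) (A, s) = 1 * of_bool s + 1"
    using block_inversion_simps[OF A A] b
    by (simp add: mak_pair_def above_upper_bound[OF A(3)] above_singleton)
  assume X: "finite X" "X \<noteq> {}" "\<forall>i\<in>X. i < N"
  note bX = bound_simps[OF X]
  show "mak_pair (A, s) (insert N X, b) = mak_pair (A, s) (X, False) + (if s then 1 else 0)"
    using block_inversion_simps[OF A X] b bX
    by (simp add: mak_pair_def above_insert[OF X(1,3)] del: Min_insert Max_insert)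
  show "mak_pair (insert N X, b) (A, s) = mak_pair (X, False) (A, s) + (if s then 1 else 1)"
    using block_inversion_simps[OF A X] b bX
    by (simp add: mak_pair_def above_insert[OF X(1,3)] above_upper_bound[OF A(3)] del: Min_insert Max_insert)
qed

text \<open>For a closed block to the right of a new one, \<open>rcs\<close> and \<open>bInv\<close>
  cancel, which gives \<open>d = 0\<close>.\<close>

interpretation lmak_scan: scan_stat lmak_pair 0 "-1" 0 "-1" "-1" 0
proof
  fix A X :: "nat set" and s b :: bool and N :: nat
  assume A: "finite A" "A \<noteq> {}" "\<forall>i\<in>A. i < N"
  note b = bound_simps[OF A]
  show "lmak_pair (A, s) ({N}, b) = 0 * of_bool s + -1"
    using block_inversion_simps[OF A A] b
    by (simp add: lmak_pair_def above_upper_bound[OF A(3)] above_singleton)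
  show "lmak_pair ({N}, b) (A, s) = 0 * of_bool s + 0"
    using block_inversion_simps[OF A A] b
    by (simp add: lmak_pair_def above_upper_bound[OF A(3)] above_singleton)
  assume X: "finite X" "X \<noteq> {}" "\<forall>i\<in>X. i < N"
  note bX = bound_simps[OF X]
  show "lmak_pair (A, s) (insert N X, b) = lmak_pair (A, s) (X, False) + (if s then -1 else -1)"
    using block_inversion_simps[OF A X] b bX
    by (simp add: lmak_pair_def above_insert[OF X(1,3)] above_upper_bound[OF A(3)] del: Min_insert Max_insert)
  show "lmak_pair (insert N X, b) (A, s) = lmak_pair (X, False) (A, s) + (if s then -1 else 0)"
    using block_inversion_simps[OF A X] b bX
    by (simp add: lmak_pair_def above_insert[OF X(1,3)] above_upper_bound[OF A(3)] del: Min_insert Max_insert)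
qed

text \<open>The value \<open>d = -1\<close> has two sources: a closed block on the left ends before
  the new element and escapes \<open>lsb\<close>, and one on the right forms a block inversion,
  which is subtracted.\<close>

interpretation lsb_scan: scan_stat lsb_pair "-1" 1 0 0 1 0
proof
  fix A X :: "nat set" and s b :: bool and N :: nat
  assume A: "finite A" "A \<noteq> {}" "\<forall>i\<in>A. i < N"
  note b = bound_simps[OF A]
  have "{i \<in> {N}. Min A < i \<and> (s \<longrightarrow> i < Max A)} = (if s then {} else {N})"
    using b by auto
  then show "lsb_pair (A, s) ({N}, b) = -1 * of_bool s + 1"
    using block_inversion_simps[OF A A] by (simp add: lsb_pair_def)
  have "card {i \<in> A. N < i \<and> (b \<longrightarrow> i < N)} = 0"
    using A by (auto simp: card_eq_0_iff)
  then show "lsb_pair ({N}, b) (A, s) = -1 * of_bool s + 0"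
    using block_inversion_simps[OF A A] by (simp add: lsb_pair_def)
  assume X: "finite X" "X \<noteq> {}" "\<forall>i\<in>X. i < N"
  note bX = bound_simps[OF X]
  have "{i \<in> insert N X. Min A < i \<and> (s \<longrightarrow> i < Max A)} =
      (if s then {} else {N}) \<union> {i \<in> X. Min A < i \<and> (s \<longrightarrow> i < Max A)}"
    using b by auto
  moreover have "N \<notin> X"
    using X(3) by blast
  ultimately show "lsb_pair (A, s) (insert N X, b) = lsb_pair (A, s) (X, False) + (if s then 0 else 1)"
    using block_inversion_simps[OF A X] X(1) by (simp add: lsb_pair_def)
  have "{i \<in> A. Min (insert N X) < i \<and> (b \<longrightarrow> i < Max (insert N X))} = {i \<in> A. Min X < i}"
    using bX A(3) by auto
  then show "lsb_pair (insert N X, b) (A, s) = lsb_pair (X, False) (A, s) + (if s then 0 else 0)"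
    using block_inversion_simps[OF A X] by (simp add: lsb_pair_def)
qed

text \<open>Joining a block leaves all minima unchanged, so only \<open>l\<close> and
  \<open>r\<close> move; a suitable \<open>\<sigma>\<close> exchanges them.\<close>

lemma (in scan_stat) scan_stat_inv_pair:
  "scan_stat (\<lambda>x y. g x y + \<sigma> * inv_pair x y) d (l - \<sigma>) (r + \<sigma>) e l' r'"
proof
  fix A X :: "nat set" and s b :: bool and N :: nat
  assume A: "finite A" "A \<noteq> {}" "\<forall>i\<in>A. i < N"
  note b = bound_simps[OF A]
  show "g (A, s) ({N}, b) + \<sigma> * inv_pair (A, s) ({N}, b) = d * of_bool s + (l - \<sigma>)"
    using new_left[OF A] b by (simp add: inv_pair_def)
  show "g ({N}, b) (A, s) + \<sigma> * inv_pair ({N}, b) (A, s) = d * of_bool s + (r + \<sigma>)"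
    using new_right[OF A] b by (simp add: inv_pair_def)
  assume X: "finite X" "X \<noteq> {}" "\<forall>i\<in>X. i < N"
  note bX = bound_simps[OF X]
  show "g (A, s) (insert N X, b) + \<sigma> * inv_pair (A, s) (insert N X, b) =
      g (A, s) (X, False) + \<sigma> * inv_pair (A, s) (X, False) + (if s then e else l')"
    using into_left[OF A X] bX by (simp add: inv_pair_def del: Min_insert)
  show "g (insert N X, b) (A, s) + \<sigma> * inv_pair (insert N X, b) (A, s) =
      g (X, False) (A, s) + \<sigma> * inv_pair (X, False) (A, s) + (if s then e else r')"
    using into_right[OF A X] bX by (simp add: inv_pair_def del: Min_insert)
qed

section \<open>From the statistics to pair sums\<close>

lemma card_pairs_conv_pair_sum:
  "int (card {(a, b). a < b \<and> b < length xs \<and> P (xs ! a) (xs ! b)}) =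
     pair_sum (\<lambda>x y. of_bool (P x y)) xs"
proof -
  have "{(a, b). a < b \<and> b < length xs \<and> P (xs ! a) (xs ! b)} =
      prod.swap ` (SIGMA b:{..<length xs}. {a \<in> {..<b}. P (xs ! a) (xs ! b)})"
    by (auto simp: image_iff)
  then have "card {(a, b). a < b \<and> b < length xs \<and> P (xs ! a) (xs ! b)} =
      card (SIGMA b:{..<length xs}. {a \<in> {..<b}. P (xs ! a) (xs ! b)})"
    by (simp add: card_image)
  also have "\<dots> = (\<Sum>b<length xs. card {a \<in> {..<b}. P (xs ! a) (xs ! b)})"
    by (simp add: card_SigmaI)
  finally show ?thesis
    by (simp add: pair_sum_conv_nth of_bool_def flip: sum.inter_filter)
qed

lemma choose_two_conv: "int (length xs choose 2) = pair_sum (\<lambda>x y. 1) xs"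
  by (induction xs) (simp_all add: Suc_choose_two sum_list_triv)

lemma sum_if_less: "b < (k::nat) \<Longrightarrow> (\<Sum>a<k. if a < b then f a else (0::int)) = (\<Sum>a<b. f a)"
proof -
  assume "b < k"
  then have "{a \<in> {..<k}. a < b} = {..<b}"
    by auto
  then show ?thesis
    by (simp flip: sum.inter_filter)
qed

locale ordered_partition =
  fixes \<pi> :: "nat set list" and n k :: nat
  assumes in_ordered_partitions: "\<pi> \<in> ordered_partitions n k"
begin

lemma length_eq: "length \<pi> = k"
  using in_ordered_partitions by (simp add: ordered_partitions_def)

lemma Union_eq: "\<Union>(set \<pi>) = {1..n}"
  using in_ordered_partitions by (simp add: ordered_partitions_def)

lemma nth_nonempty: "b < k \<Longrightarrow> \<pi> ! b \<noteq> {}"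
  using in_ordered_partitions by (auto simp: ordered_partitions_def)

lemma nth_finite: "b < k \<Longrightarrow> finite (\<pi> ! b)"
  using Union_eq length_eq nth_mem finite_subset by (metis Union_upper finite_atLeastAtMost)

lemma nth_unique: "a < k \<Longrightarrow> b < k \<Longrightarrow> i \<in> \<pi> ! a \<Longrightarrow> i \<in> \<pi> ! b \<Longrightarrow> a = b"
  using in_ordered_partitions by (auto simp: ordered_partitions_def disjoint_family_on_def)

lemma block_eq: "b < k \<Longrightarrow> i \<in> \<pi> ! b \<Longrightarrow> block \<pi> i = b"
  unfolding block_def by (rule the_equality) (auto simp: length_eq dest: nth_unique)

lemma Union_conv_nth: "\<Union>(set \<pi>) = (\<Union>b<k. \<pi> ! b)"
  using length_eq by (auto simp: set_conv_nth)

lemma stat_sum_conv_blocks: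
  "stat_sum s \<pi> = (\<Sum>b<k. \<Sum>i\<in>\<pi> ! b. int (s \<pi> i))"
  unfolding stat_sum_def Union_conv_nth
  by (subst sum.UNION_disjoint) (use nth_finite nth_unique in auto)

text \<open>For \<open>h\<close> equal to \<open>Min\<close> or \<open>Max\<close>, this counts
  openers or closers by block positions; disjoint blocks have distinct representatives.\<close>

lemma card_representatives:
  assumes "\<And>b. b < k \<Longrightarrow> h (\<pi> ! b) \<in> \<pi> ! b"
  shows "card {j \<in> h ` set \<pi>. j < i \<and> R (block \<pi> j)} = card {b. b < k \<and> h (\<pi> ! b) < i \<and> R b}"
proof (rule bij_betw_same_card[symmetric], rule bij_betw_imageI)
  show "inj_on (\<lambda>b. h (\<pi> ! b)) {b. b < k \<and> h (\<pi> ! b) < i \<and> R b}"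
    using assms nth_unique by (auto simp: inj_on_def) metis
  show "(\<lambda>b. h (\<pi> ! b)) ` {b. b < k \<and> h (\<pi> ! b) < i \<and> R b} =
      {j \<in> h ` set \<pi>. j < i \<and> R (block \<pi> j)}"
    using assms block_eq by (fastforce simp: set_conv_nth length_eq image_iff)
qed

text \<open>Double counting of the pairs formed by an element of block \<open>b\<close> and a block
  \<open>b'\<close>.\<close>

lemma sum_blocks_swap:
  assumes "\<And>b i. b < k \<Longrightarrow> i \<in> \<pi> ! b \<Longrightarrow> s \<pi> i = card {b'. b' < k \<and> P (\<pi> ! b') i \<and> R b' b}"
  shows "stat_sum s \<pi> =
    (\<Sum>b<k. \<Sum>b'<k. if R b' b then int (card {i \<in> \<pi> ! b. P (\<pi> ! b') i}) else 0)"
proof -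
  have "(\<Sum>i\<in>\<pi> ! b. int (s \<pi> i)) =
      (\<Sum>b'<k. if R b' b then int (card {i \<in> \<pi> ! b. P (\<pi> ! b') i}) else 0)" if b: "b < k" for b
  proof -
    have "(\<Sum>i\<in>\<pi> ! b. int (s \<pi> i)) =
        (\<Sum>i\<in>\<pi> ! b. \<Sum>b'<k. if P (\<pi> ! b') i \<and> R b' b then 1 else 0)"
    proof (intro sum.cong refl)
      fix i assume "i \<in> \<pi> ! b"
      then have "s \<pi> i = card {b' \<in> {..<k}. P (\<pi> ! b') i \<and> R b' b}"
        using assms[OF b] by simp
      then show "int (s \<pi> i) = (\<Sum>b'<k. if P (\<pi> ! b') i \<and> R b' b then 1 else 0)"
        by (simp only: sum.inter_filter[symmetric] finite_lessThan) simp
    qed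
    also have "\<dots> = (\<Sum>b'<k. \<Sum>i\<in>\<pi> ! b. if P (\<pi> ! b') i \<and> R b' b then 1 else 0)"
      by (rule sum.swap)
    also have "\<dots> = (\<Sum>b'<k. if R b' b then int (card {i \<in> \<pi> ! b. P (\<pi> ! b') i}) else 0)"
      using nth_finite[OF b] by (intro sum.cong refl) (simp flip: sum.inter_filter)
    finally show ?thesis .
  qed
  then show ?thesis
    by (simp add: stat_sum_conv_blocks)
qed

lemma stat_sum_left:
  assumes "\<And>b i. b < k \<Longrightarrow> i \<in> \<pi> ! b \<Longrightarrow> s \<pi> i = card {b'. b' < k \<and> P (\<pi> ! b') i \<and> b' < b}"
  shows "stat_sum s \<pi> = pair_sum (\<lambda>A B. int (card {i \<in> B. P A i})) \<pi>"
proof -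
  have "stat_sum s \<pi> =
      (\<Sum>b<k. \<Sum>b'<k. if b' < b then int (card {i \<in> \<pi> ! b. P (\<pi> ! b') i}) else 0)"
    using assms by (rule sum_blocks_swap)
  also have "\<dots> = (\<Sum>b<k. \<Sum>a<b. int (card {i \<in> \<pi> ! b. P (\<pi> ! a) i}))"
    by (rule sum.cong) (simp_all add: sum_if_less)
  finally show ?thesis
    by (simp add: pair_sum_conv_nth length_eq)
qed

lemma stat_sum_right:
  assumes "\<And>b i. b < k \<Longrightarrow> i \<in> \<pi> ! b \<Longrightarrow> s \<pi> i = card {b'. b' < k \<and> P (\<pi> ! b') i \<and> b < b'}"
  shows "stat_sum s \<pi> = pair_sum (\<lambda>A B. int (card {i \<in> A. P B i})) \<pi>"
proof -
  have "stat_sum s \<pi> =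
      (\<Sum>b<k. \<Sum>b'<k. if b < b' then int (card {i \<in> \<pi> ! b. P (\<pi> ! b') i}) else 0)"
    using assms by (rule sum_blocks_swap)
  \<comment> \<open>The sums are exchanged so that the larger index is outermost, as in
    \<open>pair_sum_conv_nth\<close>.\<close>
  also have "\<dots> = (\<Sum>b<k. \<Sum>a<b. int (card {i \<in> \<pi> ! a. P (\<pi> ! b) i}))"
    by (subst sum.swap, rule sum.cong) (simp_all add: sum_if_less)
  finally show ?thesis
    by (simp add: pair_sum_conv_nth length_eq)
qed

lemma Min_in_nth: "b < k \<Longrightarrow> Min (\<pi> ! b) \<in> \<pi> ! b"
  using nth_finite nth_nonempty by simp

lemma Max_in_nth: "b < k \<Longrightarrow> Max (\<pi> ! b) \<in> \<pi> ! b"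
  using nth_finite nth_nonempty by simp

lemma stat_sum_ros: "stat_sum ros_at \<pi> = pair_sum (\<lambda>A B. above A (Min B)) \<pi>"
  unfolding above_def
  by (rule stat_sum_right[where P = "\<lambda>B i. Min B < i"])
    (simp add: ros_at_def openers_def block_eq
      card_representatives[of Min _ "\<lambda>b'. b' > _", OF Min_in_nth])

lemma stat_sum_los: "stat_sum los_at \<pi> = pair_sum (\<lambda>A B. above B (Min A)) \<pi>"
  unfolding above_def
  by (rule stat_sum_left[where P = "\<lambda>B i. Min B < i"])
    (simp add: los_at_def openers_def block_eq
      card_representatives[of Min _ "\<lambda>b'. b' < _", OF Min_in_nth])

lemma stat_sum_rcs: "stat_sum rcs_at \<pi> = pair_sum (\<lambda>A B. above A (Max B)) \<pi>"
  unfolding above_def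
  by (rule stat_sum_right[where P = "\<lambda>B i. Max B < i"])
    (simp add: rcs_at_def closers_def block_eq
      card_representatives[of Max _ "\<lambda>b'. b' > _", OF Max_in_nth])

lemma stat_sum_lcs: "stat_sum lcs_at \<pi> = pair_sum (\<lambda>A B. above B (Max A)) \<pi>"
  unfolding above_def
  by (rule stat_sum_left[where P = "\<lambda>B i. Max B < i"])
    (simp add: lcs_at_def closers_def block_eq
      card_representatives[of Max _ "\<lambda>b'. b' < _", OF Max_in_nth])

lemma stat_sum_lsb:
  "stat_sum lsb_at \<pi> = pair_sum (\<lambda>A B. int (card {i \<in> B. Min A < i \<and> i < Max A})) \<pi>"
proof (rule stat_sum_left[where P = "\<lambda>B i. Min B < i \<and> i < Max B"])
  fix b i assume b: "b < k" "i \<in> \<pi> ! b"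
  have "{b'. b' < b \<and> Min (\<pi> ! b') < i \<and> i < Max (\<pi> ! b')} =
      {b'. b' < k \<and> (Min (\<pi> ! b') < i \<and> i < Max (\<pi> ! b')) \<and> b' < b}"
    using b by auto
  then show "lsb_at \<pi> i = card {b'. b' < k \<and> (Min (\<pi> ! b') < i \<and> i < Max (\<pi> ! b')) \<and> b' < b}"
    by (simp add: lsb_at_def block_eq[OF b])
qed

lemma bInv_conv: "bInv \<pi> = pair_sum (\<lambda>A B. of_bool (Max B < Min A)) \<pi>"
proof -
  have "{(a, b). a < b \<and> b < length \<pi> \<and> (\<forall>x\<in>\<pi> ! a. \<forall>y\<in>\<pi> ! b. x > y)} =
      {(a, b). a < b \<and> b < length \<pi> \<and> Max (\<pi> ! b) < Min (\<pi> ! a)}"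
    using nth_finite nth_nonempty length_eq by auto
  then show ?thesis
    by (simp add: bInv_def card_pairs_conv_pair_sum[of \<pi> "\<lambda>A B. Max B < Min A"])
qed

text \<open>\<open>inv - cinv\<close> equals \<open>2 * inv - (k choose 2)\<close>, so each pair of
  blocks contributes \<open>1\<close> or \<open>-1\<close>.\<close>

lemma inv_cinv_conv:
  "op_inv \<pi> - op_cinv \<pi> = pair_sum inv_pair (map (\<lambda>B. (B, True)) \<pi>)"
proof -
  have "op_inv \<pi> = pair_sum (\<lambda>A B. of_bool (Min B < Min A)) \<pi>"
    by (simp add: op_inv_def card_pairs_conv_pair_sum[of \<pi> "\<lambda>A B. Min B < Min A"])
  then have "op_inv \<pi> - op_cinv \<pi> =
      2 * pair_sum (\<lambda>A B. of_bool (Min B < Min A)) \<pi> - pair_sum (\<lambda>A B. 1) \<pi>"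
    by (simp add: op_cinv_def choose_two_conv)
  then show ?thesis
    by (simp add: pair_sum_map inv_pair_def pair_sum_conv_nth sum_subtractf sum_distrib_left mult.commute)
qed

lemma mak_conv: "mak \<pi> + bInv \<pi> = pair_sum mak_pair (map (\<lambda>B. (B, True)) \<pi>)"
  by (simp add: mak_def stat_sum_ros stat_sum_lcs bInv_conv pair_sum_map mak_pair_def
      block_inversion_def pair_sum_add)

lemma lmak_conv:
  "lmak \<pi> + bInv \<pi> = int n * (int k - 1) + pair_sum lmak_pair (map (\<lambda>B. (B, True)) \<pi>)"
  by (simp add: lmak_def stat_sum_los stat_sum_rcs bInv_conv pair_sum_map lmak_pair_def
      block_inversion_def Union_eq length_eq pair_sum_conv_nth sum.distrib sum_subtractf sum_negf)

lemma cinvLSB_conv: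
  "cinvLSB \<pi> = 2 * int (k choose 2) + pair_sum lsb_pair (map (\<lambda>B. (B, True)) \<pi>)"
  by (simp add: cinvLSB_def stat_sum_lsb bInv_conv pair_sum_map lsb_pair_def
      block_inversion_def length_eq pair_sum_conv_nth sum_subtractf)

end

section \<open>The six equidistributions\<close>

text \<open>\<open>(X - 1) * [n] = X ^ n - 1\<close>, and the subdegree of \<open>X ^ n\<close>
  distinguishes it from \<open>1\<close>.\<close>

interpretation fls: generic_q "fls_X :: rat fls"
proof
  fix n :: nat assume "n > 0"
  have "(fls_X - 1) * q_int fls_X n = fls_X ^ n - (1 :: rat fls)"
    unfolding q_int_def by (rule power_diff_1_eq[symmetric])
  moreover have "fls_X ^ n \<noteq> (1 :: rat fls)"
  proof
    assume "fls_X ^ n = (1 :: rat fls)"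
    then have "fls_subdegree (fls_X ^ n :: rat fls) = 0"
      by simp
    then show False
      using \<open>n > 0\<close> by (simp add: fls_subdegree_pow)
  qed
  ultimately show "q_int fls_X n \<noteq> (0 :: rat fls)"
    by auto
qed simp

lemma euler_mahonianI:
  assumes "\<And>\<pi>. \<pi> \<in> ordered_partitions n k \<Longrightarrow>
      stat \<pi> = C + pair_sum g (map (\<lambda>B. (B, True)) \<pi>)"
    and "scan_stat g d l r e l' r'"
    and "fls_X powi C * scan_stat.weight_sum g (fls_X :: rat fls) n k 0 =
      q_fact fls_X k * q_stirling fls_X n k"
  shows "euler_mahonian n k stat"
proof -
  interpret scan_stat g d l r e l' r' by fact
  have "(\<Sum>\<pi>\<in>ordered_partitions n k. (fls_X :: rat fls) powi stat \<pi>) =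
      (\<Sum>\<pi>\<in>ordered_partitions n k. fls_X powi C * fls_X powi pair_sum g (map (\<lambda>B. (B, True)) \<pi>))"
    by (rule sum.cong) (simp_all only: assms(1) power_int_add[OF disjI1[OF fls.q_nonzero]])
  also have "\<dots> = fls_X powi C * weight_sum fls_X n k 0"
    by (simp only: sum_ordered_partitions_conv_weight_sum flip: sum_distrib_left)
  finally show ?thesis
    unfolding euler_mahonian_def Let_def using assms(3) by simp
qed

lemma geom_values:
  assumes "q \<noteq> 0"
  shows "geom q 1 0 N = q_int q N" "geom q 0 1 N = q_int q N"
    "geom q (-1) 0 N = q powi (1 - int N) * q_int q N"
    "geom q 0 (-1) N = q powi (1 - int N) * q_int q N"
  using geom_1_0[of q N] geom_minus_1_0[OF assms, of N] geom_swap[of q 0] by simp_all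

lemma euler_mahonian_mak_type:
  assumes "\<And>\<pi>. \<pi> \<in> ordered_partitions n k \<Longrightarrow> stat \<pi> = pair_sum g (map (\<lambda>B. (B, True)) \<pi>)"
    and "scan_stat g 1 l r 1 0 1" and "(l, r) \<in> {(0, 1), (1, 0)}"
  shows "euler_mahonian n k stat"
proof -
  interpret scan_stat g 1 l r 1 0 1 by fact
  interpret generic_scan "fls_X :: rat fls" g 1 l r 1 0 1 ..
  have "weight_sum (fls_X :: rat fls) n k 0 = q_fact fls_X k * q_stirling fls_X n k"
    by (rule weight_sum_mak_type)
      (use assms(3) in \<open>auto simp: new_weight_def into_weight_def geom_values\<close>)
  then show ?thesis
    using assms by (intro euler_mahonianI[where C = 0]) auto
qed

lemma euler_mahonian_lmak_type:
  assumes "\<And>\<pi>. \<pi> \<in> ordered_partitions n k \<Longrightarrow>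
      stat \<pi> = int n * (int k - 1) + pair_sum g (map (\<lambda>B. (B, True)) \<pi>)"
    and "scan_stat g 0 l r (-1) (-1) 0" and "(l, r) \<in> {(-1, 0), (0, -1)}"
  shows "euler_mahonian n k stat"
proof -
  interpret scan_stat g 0 l r "-1" "-1" 0 by fact
  interpret generic_scan "fls_X :: rat fls" g 0 l r "-1" "-1" 0 ..
  have "fls_X powi (int n * (int k - 1)) * weight_sum (fls_X :: rat fls) n k 0 =
      q_fact fls_X k * q_stirling fls_X n k"
  proof (rule weight_sum_lmak_type)
    fix c a :: nat
    show "new_weight (fls_X :: rat fls) c a = fls_X powi - int (c + a) * q_int fls_X (Suc (c + a))"
      using assms(3) by (auto simp: new_weight_def geom_values)
    have "- int c + (1 - int a) = 1 - int (c + a)"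
      by simp
    then have "fls_X powi - int c * fls_X powi (1 - int a) = (fls_X powi (1 - int (c + a)) :: rat fls)"
      by (simp only: power_int_add[OF disjI1[OF fls.q_nonzero], symmetric])
    then show "into_weight (fls_X :: rat fls) c a = fls_X powi (1 - int (c + a)) * q_int fls_X a"
      by (simp add: into_weight_def geom_values mult.assoc[symmetric])
  qed
  then show ?thesis
    using assms by (intro euler_mahonianI) auto
qed

lemma euler_mahonian_lsb_type:
  assumes "\<And>\<pi>. \<pi> \<in> ordered_partitions n k \<Longrightarrow>
      stat \<pi> = 2 * int (k choose 2) + pair_sum g (map (\<lambda>B. (B, True)) \<pi>)"
    and "scan_stat g (-1) l r 0 1 0" and "(l, r) \<in> {(1, 0), (0, 1)}"
  shows "euler_mahonian n k stat"
proof -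
  interpret scan_stat g "-1" l r 0 1 0 by fact
  interpret generic_scan "fls_X :: rat fls" g "-1" l r 0 1 0 ..
  have "fls_X powi (2 * int (k choose 2)) * weight_sum (fls_X :: rat fls) n k 0 =
      q_fact fls_X k * q_stirling fls_X n k"
    by (rule weight_sum_lsb_type)
      (use assms(3) in \<open>auto simp: new_weight_def into_weight_def geom_values\<close>)
  then show ?thesis
    using assms by (intro euler_mahonianI) auto
qed

theorem theorem2p4:
  fixes n k :: nat
  assumes "n \<ge> 1" and "k \<ge> 1"
  shows "euler_mahonian n k (\<lambda>\<pi>. mak \<pi> + bInv \<pi>)
      \<and> euler_mahonian n k (\<lambda>\<pi>. mak \<pi> + bInv \<pi> - (op_inv \<pi> - op_cinv \<pi>))
      \<and> euler_mahonian n k (\<lambda>\<pi>. lmak \<pi> + bInv \<pi>)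
      \<and> euler_mahonian n k (\<lambda>\<pi>. lmak \<pi> + bInv \<pi> - (op_inv \<pi> - op_cinv \<pi>))
      \<and> euler_mahonian n k (\<lambda>\<pi>. cinvLSB \<pi>)
      \<and> euler_mahonian n k (\<lambda>\<pi>. cinvLSB \<pi> + (op_inv \<pi> - op_cinv \<pi>))"
proof (intro conjI)
  note op = ordered_partition.intro[of _ n k]
  note convs = ordered_partition.mak_conv[OF op] ordered_partition.lmak_conv[OF op]
    ordered_partition.cinvLSB_conv[OF op] ordered_partition.inv_cinv_conv[OF op]
    pair_sum_add pair_sum_diff
  show "euler_mahonian n k (\<lambda>\<pi>. mak \<pi> + bInv \<pi>)"
    by (rule euler_mahonian_mak_type[OF _ mak_scan.scan_stat_axioms]) (simp_all add: convs)
  \<comment> \<open>\<open>\<sigma> = -1\<close> turns \<open>(l, r) = (0, 1)\<close> into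
    \<open>(1, 0)\<close>.\<close>
  show "euler_mahonian n k (\<lambda>\<pi>. mak \<pi> + bInv \<pi> - (op_inv \<pi> - op_cinv \<pi>))"
    by (rule euler_mahonian_mak_type[OF _ mak_scan.scan_stat_inv_pair[of "-1"]])
      (simp_all add: convs)
  show "euler_mahonian n k (\<lambda>\<pi>. lmak \<pi> + bInv \<pi>)"
    by (rule euler_mahonian_lmak_type[OF _ lmak_scan.scan_stat_axioms]) (simp_all add: convs)
  \<comment> \<open>\<open>\<sigma> = -1\<close> turns \<open>(l, r) = (-1, 0)\<close> into
    \<open>(0, -1)\<close>.\<close>
  show "euler_mahonian n k (\<lambda>\<pi>. lmak \<pi> + bInv \<pi> - (op_inv \<pi> - op_cinv \<pi>))"
    by (rule euler_mahonian_lmak_type[OF _ lmak_scan.scan_stat_inv_pair[of "-1"]])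
      (simp_all add: convs)
  show "euler_mahonian n k (\<lambda>\<pi>. cinvLSB \<pi>)"
    by (rule euler_mahonian_lsb_type[OF _ lsb_scan.scan_stat_axioms]) (simp_all add: convs)
  \<comment> \<open>\<open>\<sigma> = 1\<close> turns \<open>(l, r) = (1, 0)\<close> into
    \<open>(0, 1)\<close>.\<close>
  show "euler_mahonian n k (\<lambda>\<pi>. cinvLSB \<pi> + (op_inv \<pi> - op_cinv \<pi>))"
    by (rule euler_mahonian_lsb_type[OF _ lsb_scan.scan_stat_inv_pair[of 1]])
      (simp_all add: convs)
qed

end
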